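(* There are sufficiently small constants $c,\gamma>0$ and an absolute constant $c'>0$ such that the following holds for $k<\log n$ and $t<n^c$. Given $t$ independent streams, each consisting of $n$ i.i.d. uniformly random bits in $\{-1,1\}$, interleaved into a single stream of $nt$ updates, any $k$-pass streaming algorithm which, at the end of its passes, holds a data structure such that with probability at least $1-\gamma$ (over the input, the algorithm's randomness, and a uniformly random $j\in[t]$ given at the end) it outputs the majority bit of the $j$-th stream, requires at least $c'\frac{t\log n}{k}$ bits of memory.
   Context: The interleaved stream consists of updates $(x,s)\in\{-1,1\}\times[t]$, where updates with second coordinate $s$ form the $s$-th stream; the interleaving is round-robin: the $\ell$-th update is associated with stream $((\ell-1)\bmod t)+1$. A $k$-pass streaming algorithm reads the whole interleaved stream in order $k$ times and may use private randomness. *)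

theory Defs
  imports "HOL-Probability.Probability"
begin

text \<open>Interleaved stream of t streams with n bits each.  The input is the
interleaved stream itself: a list xs of length n*t of bits (True = +1,
False = -1).  Update number l (0-based) is (bit (xs!l), l mod t + 1), i.e. it
belongs to stream ((l+1-1) mod t)+1 (round robin), and it is the
(l div t)-th bit of that stream.  A uniformly random such list is exactly t
independent streams of n i.i.d. uniform bits.\<close>

definition bitval :: "bool \<Rightarrow> int" where
  "bitval b = (if b then 1 else -1)"

definition inputs :: "nat \<Rightarrow> nat \<Rightarrow> bool list set" where
  "inputs n t = {xs. length xs = n * t}"

definition majority :: "nat \<Rightarrow> nat \<Rightarrow> bool list \<Rightarrow> nat \<Rightarrow> int" where
  "majority n t xs j =
     (if (\<Sum>i<n. bitval (xs ! (i * t + j))) \<ge> 0 then 1 else -1)"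

text \<open>A streaming algorithm with states coded as natural numbers, private
random seed r, an initial state, a transition function
step r p l (x,s) \<sigma> (pass p, position l, update (x,s)), and an output
function out r j \<sigma> answering the query j from the final state.\<close>

definition run_pass ::
  "(nat \<Rightarrow> nat \<Rightarrow> nat \<Rightarrow> int \<times> nat \<Rightarrow> nat \<Rightarrow> nat) \<Rightarrow> nat \<Rightarrow> nat \<Rightarrow> bool list \<Rightarrow> nat \<Rightarrow> nat \<Rightarrow> nat" where
  "run_pass step r t xs p \<sigma> =
     fold (\<lambda>l \<sigma>'. step r p l (bitval (xs ! l), l mod t + 1) \<sigma>') [0..<length xs] \<sigma>"

definition run_all ::
  "(nat \<Rightarrow> nat) \<Rightarrow> (nat \<Rightarrow> nat \<Rightarrow> nat \<Rightarrow> int \<times> nat \<Rightarrow> nat \<Rightarrow> nat) \<Rightarrow> nat \<Rightarrow> nat \<Rightarrow> nat \<Rightarrow> bool list \<Rightarrow> nat" where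
  "run_all init step k r t xs = fold (run_pass step r t xs) [0..<k] (init r)"

definition memory_bounded ::
  "nat \<Rightarrow> nat \<Rightarrow> nat \<Rightarrow> nat \<Rightarrow> (nat \<Rightarrow> nat) \<Rightarrow> (nat \<Rightarrow> nat \<Rightarrow> nat \<Rightarrow> int \<times> nat \<Rightarrow> nat \<Rightarrow> nat) \<Rightarrow> bool" where
  "memory_bounded s n t k init step \<longleftrightarrow>
     (\<forall>r. init r < 2 ^ s) \<and>
     (\<forall>r. \<forall>p<k. \<forall>l<n * t. \<forall>u \<sigma>. \<sigma> < 2 ^ s \<longrightarrow> step r p l u \<sigma> < 2 ^ s)"

definition success_prob ::
  "nat \<Rightarrow> nat \<Rightarrow> nat \<Rightarrow> nat pmf \<Rightarrow> (nat \<Rightarrow> nat) \<Rightarrow> (nat \<Rightarrow> nat \<Rightarrow> nat \<Rightarrow> int \<times> nat \<Rightarrow> nat \<Rightarrow> nat)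
     \<Rightarrow> (nat \<Rightarrow> nat \<Rightarrow> nat \<Rightarrow> int) \<Rightarrow> real" where
  "success_prob n t k R init step out =
     measure_pmf.prob
       (pmf_of_set (inputs n t) \<bind> (\<lambda>xs. R \<bind> (\<lambda>r. pmf_of_set {..<t} \<bind>
          (\<lambda>j. return_pmf (xs, r, j)))))
       {(xs, r, j). out r j (run_all init step k r t xs) = majority n t xs j}"

end

theory Submission
  imports Defs
begin

text \<open>Fix the random seed and let \<open>Z l\<close> be the list of the \<open>k\<close> memory states at position \<open>l\<close>, one
  for each pass. Inputs that agree on \<open>Z a\<close> and \<open>Z b\<close> can exchange their bits between \<open>a\<close> and
  \<open>b\<close>. Hence, if the sum \<open>S\<close> of a stream is split into sums \<open>S b\<close> of consecutive blocks, the
  conditional expectations \<open>e b\<close> of \<open>S b\<close> given \<open>Z\<close> at the two ends of block \<open>b\<close> are pairwise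
  orthogonal and \<open>E (S g) = E ((\<Sum>b. e b) g)\<close> for every function \<open>g\<close> of the final memory. Since
  the answer correlates with \<open>S\<close>, at every block length \<open>m\<close> an average block has
  \<open>E (e b)\<^sup>2 = \<Omega>(m)\<close>, and this persists if the last \<open>m / 512\<close> bits of the block are dropped.
  For \<open>m = 512 ^ i\<close> the truncated windows that end at a common position \<open>l\<close> are disjoint. The
  entropy chain rule, with the bits revealed one by one given \<open>Z l\<close> and the final \<open>Z\<close>, bounds
  the sum of \<open>E (e b)\<^sup>2 / m\<close> over all scales and all streams by \<open>O(k s)\<close>, while it is
  \<open>\<Omega>(t log n)\<close> for an average \<open>l\<close>.\<close>

section \<open>Conditional averages\<close>

text \<open>The conditional expectation of \<open>f\<close> given \<open>\<kappa>\<close>, for the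
  uniform distribution on \<open>A\<close>.\<close>

definition cavg :: "'a set \<Rightarrow> ('a \<Rightarrow> 'c) \<Rightarrow> ('a \<Rightarrow> real) \<Rightarrow> 'a \<Rightarrow> real" where
  "cavg A \<kappa> f x = (\<Sum>y | y \<in> A \<and> \<kappa> y = \<kappa> x. f y) / real (card {y \<in> A. \<kappa> y = \<kappa> x})"

lemma cavg_cong_class: "\<kappa> x = \<kappa> y \<Longrightarrow> cavg A \<kappa> f x = cavg A \<kappa> f y"
  by (simp add: cavg_def)

lemma cavg_add: "cavg A \<kappa> (\<lambda>x. f x + g x) x = cavg A \<kappa> f x + cavg A \<kappa> g x"
  by (simp add: cavg_def sum.distrib add_divide_distrib)

text \<open>\<open>(x, y) \<mapsto> (mx x y, mx y x)\<close> is an involution on the pairs inside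
  one class of \<open>\<kappa>\<close>; it trades the \<open>f\<close>-values of \<open>x\<close>
  and \<open>y\<close> and leaves the \<open>h\<close>-values. Hence \<open>f\<close> and
  \<open>h\<close> are uncorrelated given \<open>\<kappa>\<close>, and \<open>f\<close> may be
  replaced by its class average although \<open>h\<close> need not be constant on classes.\<close>

lemma sum_cavg_exchange:
  fixes A :: "'a set"
  assumes fin: "finite A"
    and mix: "\<And>x y. x \<in> A \<Longrightarrow> y \<in> A \<Longrightarrow> \<kappa> x = \<kappa> y \<Longrightarrow>
      mx x y \<in> A \<and> \<kappa> (mx x y) = \<kappa> x \<and> h (mx x y) = h x \<and> f (mx x y) = f y \<and>
      mx (mx x y) (mx y x) = x"
  shows "(\<Sum>x\<in>A. f x * h x) = (\<Sum>x\<in>A. cavg A \<kappa> f x * h x)"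
proof -
  let ?C = "\<lambda>x. {y \<in> A. \<kappa> y = \<kappa> x}"
  let ?c = "\<lambda>x. real (card (?C x))"
  let ?P = "SIGMA x:A. ?C x"
  have cpos: "?c x > 0" if "x \<in> A" for x
    using that fin by (auto simp: card_gt_0_iff)
  have "(\<Sum>x\<in>A. f x * h x) = (\<Sum>x\<in>A. \<Sum>y\<in>?C x. f x * h x / ?c x)"
  proof (intro sum.cong refl)
    fix x assume "x \<in> A"
    hence "?c x \<noteq> 0" using cpos by force
    thus "f x * h x = (\<Sum>y\<in>?C x. f x * h x / ?c x)" by (simp only: sum_constant) simp
  qed
  also have "\<dots> = (\<Sum>(x,y)\<in>?P. f x * h x / ?c x)"
    using fin by (subst sum.Sigma) auto
  also have "\<dots> = (\<Sum>(x,y)\<in>?P. f y * h x / ?c x)"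
  proof (rule sum.reindex_bij_witness
      [where i = "\<lambda>(x,y). (mx x y, mx y x)" and j = "\<lambda>(x,y). (mx x y, mx y x)"])
  next
    fix a assume a: "a \<in> ?P"
    then obtain x y where xy: "a = (x,y)" "x \<in> A" "y \<in> A" "\<kappa> x = \<kappa> y" by auto
    note m = mix[OF xy(2-4)] mix[OF xy(3,2) xy(4)[symmetric]]
    show "(case case a of (x, y) \<Rightarrow> (mx x y, mx y x) of (x, y) \<Rightarrow> (mx x y, mx y x)) = a"
      using m xy by auto
    show "(case a of (x, y) \<Rightarrow> (mx x y, mx y x)) \<in> ?P"
      using m xy by auto
    show "(case case a of (x, y) \<Rightarrow> (mx x y, mx y x) of (x, y) \<Rightarrow> (mx x y, mx y x)) = a"
      using m xy by auto
    show "(case a of (x, y) \<Rightarrow> (mx x y, mx y x)) \<in> ?P"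
      using m xy by auto
    show "(case case a of (x, y) \<Rightarrow> (mx x y, mx y x) of (x, y) \<Rightarrow> f y * h x / ?c x) =
         (case a of (x, y) \<Rightarrow> f x * h x / ?c x)"
      using m xy by auto
  qed
  also have "\<dots> = (\<Sum>x\<in>A. \<Sum>y\<in>?C x. f y * h x / ?c x)"
    using fin by (subst sum.Sigma) auto
  also have "\<dots> = (\<Sum>x\<in>A. cavg A \<kappa> f x * h x)"
    by (simp add: cavg_def sum_distrib_right sum_divide_distrib)
  finally show ?thesis .
qed

lemma sum_cavg_mult:
  assumes "finite A" and "\<And>x y. x \<in> A \<Longrightarrow> y \<in> A \<Longrightarrow> \<kappa> x = \<kappa> y \<Longrightarrow> h x = h y"
  shows "(\<Sum>x\<in>A. f x * h x) = (\<Sum>x\<in>A. cavg A \<kappa> f x * h x)"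
\<comment> \<open>For \<open>h\<close> constant on classes, the plain swap of the pair is already
  such an exchange.\<close>
proof (rule sum_cavg_exchange[where mx = "\<lambda>x y. y"])
  fix x y assume "x \<in> A" "y \<in> A" "\<kappa> x = \<kappa> y"
  then show "y \<in> A \<and> \<kappa> y = \<kappa> x \<and> h y = h x \<and> f y = f y \<and> x = x"
    using assms(2)[of y x] by simp
qed (fact assms(1))

lemma sum_cavg_power2:
  assumes "finite A"
  shows "(\<Sum>x\<in>A. (cavg A \<kappa> f x)\<^sup>2) = (\<Sum>x\<in>A. f x * cavg A \<kappa> f x)"
  unfolding power2_eq_square
  by (rule sum_cavg_mult[OF assms, symmetric]) (rule cavg_cong_class)

text \<open>Expand the square of \<open>v - u\<close>. The hypothesis holds whenever
  \<open>u\<close> is an orthogonal projection of \<open>v\<close>, as for conditional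
  averages.\<close>

lemma sum_power2_le_of_cross:
  fixes u v :: "'a \<Rightarrow> real"
  assumes "(\<Sum>x\<in>A. (u x)\<^sup>2) = (\<Sum>x\<in>A. v x * u x)"
  shows "(\<Sum>x\<in>A. (u x)\<^sup>2) \<le> (\<Sum>x\<in>A. (v x)\<^sup>2)"
proof -
  have "0 \<le> (\<Sum>x\<in>A. (v x - u x)\<^sup>2)" by (simp add: sum_nonneg)
  also have "\<dots> = (\<Sum>x\<in>A. (v x)\<^sup>2) + (\<Sum>x\<in>A. (u x)\<^sup>2) - 2 * (\<Sum>x\<in>A. v x * u x)"
    by (simp add: power2_diff sum.distrib sum_subtractf sum_distrib_left mult.assoc)
  finally show ?thesis using assms by simp
qed

lemma sum_cavg_power2_le:
  assumes "finite A"
  shows "(\<Sum>x\<in>A. (cavg A \<kappa> f x)\<^sup>2) \<le> (\<Sum>x\<in>A. (f x)\<^sup>2)"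
  by (rule sum_power2_le_of_cross[OF sum_cavg_power2[OF assms]])

section \<open>Sums of random signs\<close>

definition bits :: "nat \<Rightarrow> bool list set" where
  "bits N = {xs. length xs = N}"

lemma finite_bits [simp]: "finite (bits N)"
  using finite_lists_length_eq[of "UNIV :: bool set" N] by (simp add: bits_def)

lemma card_bits [simp]: "card (bits N) = 2 ^ N"
  using card_lists_length_eq[of "UNIV :: bool set" N] by (simp add: bits_def)

definition coin :: "nat \<Rightarrow> bool list \<Rightarrow> real" where
  "coin p x = real_of_int (bitval (x ! p))"

lemma coin_power2 [simp]: "(coin p x)\<^sup>2 = 1"
  by (simp add: coin_def bitval_def)

lemma coin_cases: "coin p x = 1 \<or> coin p x = -1"
  by (simp add: coin_def bitval_def)

definition coinsum :: "nat set \<Rightarrow> bool list \<Rightarrow> real" where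
  "coinsum Q x = (\<Sum>p\<in>Q. coin p x)"

text \<open>Flipping bit \<open>p\<close> pairs up inputs whose terms cancel.\<close>

lemma sum_coin_eq_0:
  assumes "p < N" and inv: "\<And>x. x \<in> bits N \<Longrightarrow> h (x[p := \<not> x ! p]) = h x"
  shows "(\<Sum>x\<in>bits N. h x * coin p x) = 0"
proof -
  let ?T = "\<lambda>x. x[p := \<not> x ! p]"
  have "(\<Sum>x\<in>bits N. h x * coin p x) = (\<Sum>x\<in>bits N. - (h x * coin p x))"
    by (rule sum.reindex_bij_witness[where i = ?T and j = ?T])
       (use assms in \<open>auto simp: bits_def coin_def bitval_def\<close>)
  thus ?thesis by (simp add: sum_negf)
qed

lemma coinsum_flip:
  assumes "p \<notin> Q"
  shows "coinsum Q (x[p := v]) = coinsum Q x"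
  unfolding coinsum_def coin_def by (intro sum.cong refl) (metis assms nth_list_update_neq)

lemma sum_coinsum_mult_coin:
  assumes "p < N" "p \<notin> Q"
  shows "(\<Sum>x\<in>bits N. coinsum Q x ^ i * coin p x) = 0"
  by (rule sum_coin_eq_0) (use assms in \<open>auto simp: coinsum_flip\<close>)

lemma sum_coinsum_mult_disjoint:
  assumes "Q \<inter> R = {}" "R \<subseteq> {..<N}"
  shows "(\<Sum>x\<in>bits N. coinsum Q x * coinsum R x) = 0"
proof -
  have "(\<Sum>x\<in>bits N. coinsum Q x * coinsum R x) =
      (\<Sum>p\<in>R. \<Sum>x\<in>bits N. coinsum Q x * coin p x)"
    by (subst sum.swap) (simp add: coinsum_def sum_distrib_left)
  also have "\<dots> = 0"
  proof (rule sum.neutral, rule ballI)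
    fix p assume "p \<in> R"
    thus "(\<Sum>x\<in>bits N. coinsum Q x * coin p x) = 0"
      using sum_coinsum_mult_coin[of p N Q 1] assms by auto
  qed
  finally show ?thesis .
qed

lemma sum_coinsum_power2:
  assumes "Q \<subseteq> {..<N}"
  shows "(\<Sum>x\<in>bits N. (coinsum Q x)\<^sup>2) = real (card Q) * real (card (bits N))"
proof -
  have "finite Q" using assms finite_subset by blast
  then show ?thesis using assms
  proof (induction Q rule: finite_induct)
    case (insert p Q)
    have "(\<Sum>x\<in>bits N. (coinsum (insert p Q) x)\<^sup>2) =
        (\<Sum>x\<in>bits N. (coinsum Q x)\<^sup>2 + 2 * (coinsum Q x ^ 1 * coin p x) + 1)"
      using insert.hyps
      by (intro sum.cong refl) (simp add: coinsum_def power2_sum)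
    also have "\<dots> = (\<Sum>x\<in>bits N. (coinsum Q x)\<^sup>2) +
        2 * (\<Sum>x\<in>bits N. coinsum Q x ^ 1 * coin p x) + real (card (bits N))"
      by (simp only: sum.distrib sum_distrib_left) simp
    also have "(\<Sum>x\<in>bits N. coinsum Q x ^ 1 * coin p x) = 0"
      using insert by (intro sum_coinsum_mult_coin) auto
    finally show ?case using insert by (simp add: algebra_simps)
  qed (simp add: coinsum_def)
qed

lemma sum_coinsum_power4:
  assumes "Q \<subseteq> {..<N}"
  shows "(\<Sum>x\<in>bits N. coinsum Q x ^ 4) \<le> 3 * (real (card Q))\<^sup>2 * real (card (bits N))"
proof -
  have "finite Q" using assms finite_subset by blast
  then show ?thesis using assms
  proof (induction Q rule: finite_induct)
    case (insert p Q)
    have *: "(u + v) ^ 4 = v^4 + 4 * (v^3 * u) + 6 * v\<^sup>2 + 4 * (v ^ 1 * u) + 1"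
      if "u = 1 \<or> u = -1" for u v :: real
      using that by (elim disjE) (simp_all add: power2_eq_square power3_eq_cube power4_eq_xxxx algebra_simps)
    have "(\<Sum>x\<in>bits N. coinsum (insert p Q) x ^ 4) =
        (\<Sum>x\<in>bits N. coinsum Q x ^ 4 + 4 * (coinsum Q x ^ 3 * coin p x) + 6 * (coinsum Q x)\<^sup>2
          + 4 * (coinsum Q x ^ 1 * coin p x) + 1)"
    proof (intro sum.cong refl)
      fix x
      have "coinsum (insert p Q) x = coin p x + coinsum Q x"
        using insert.hyps by (simp add: coinsum_def)
      then show "coinsum (insert p Q) x ^ 4 = coinsum Q x ^ 4 + 4 * (coinsum Q x ^ 3 * coin p x)
          + 6 * (coinsum Q x)\<^sup>2 + 4 * (coinsum Q x ^ 1 * coin p x) + 1"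
        by (simp only: *[OF coin_cases])
    qed
    also have "\<dots> = (\<Sum>x\<in>bits N. coinsum Q x ^ 4) + 4 * (\<Sum>x\<in>bits N. coinsum Q x ^ 3 * coin p x)
        + 6 * (\<Sum>x\<in>bits N. (coinsum Q x)\<^sup>2) + 4 * (\<Sum>x\<in>bits N. coinsum Q x ^ 1 * coin p x)
        + real (card (bits N))"
      by (simp only: sum.distrib sum_distrib_left) simp
    also have "(\<Sum>x\<in>bits N. coinsum Q x ^ 1 * coin p x) = 0"
      using insert by (intro sum_coinsum_mult_coin) auto
    also have "(\<Sum>x\<in>bits N. coinsum Q x ^ 3 * coin p x) = 0"
      using insert by (intro sum_coinsum_mult_coin) auto
    also have "(\<Sum>x\<in>bits N. (coinsum Q x)\<^sup>2) = real (card Q) * real (card (bits N))"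
      using insert by (intro sum_coinsum_power2) auto
    also have "(\<Sum>x\<in>bits N. coinsum Q x ^ 4) \<le> 3 * (real (card Q))\<^sup>2 * real (card (bits N))"
      using insert by auto
    finally have "(\<Sum>x\<in>bits N. coinsum (insert p Q) x ^ 4) \<le>
        (3 * (real (card Q))\<^sup>2 + 6 * real (card Q) + 1) * real (card (bits N))"
      by (simp add: algebra_simps)
    also have "\<dots> \<le> 3 * (real (card (insert p Q)))\<^sup>2 * real (card (bits N))"
      using insert by (intro mult_right_mono) (simp_all add: power2_eq_square algebra_simps)
    finally show ?case .
  qed (simp add: coinsum_def)
qed

text \<open>A pointwise lower bound of \<open>\<bar>y\<bar>\<close> by \<open>y\<^sup>2\<close> and
  \<open>y^4\<close> passes to the mean: with second moment \<open>s\<^sup>2\<close> and fourth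
  moment at most \<open>3 * s^4\<close> it leaves \<open>s - 3/4 * s\<close>.\<close>

lemma sum_abs_coinsum_ge:
  assumes "Q \<subseteq> {..<N}" "Q \<noteq> {}"
  shows "(\<Sum>x\<in>bits N. \<bar>coinsum Q x\<bar>) \<ge> sqrt (real (card Q)) / 4 * real (card (bits N))"
proof -
  define s where "s = sqrt (real (card Q))"
  have "finite Q" using assms finite_subset by blast
  hence s: "s > 0" "s\<^sup>2 = real (card Q)" using assms by (auto simp: s_def card_gt_0_iff)
  have pt: "y\<^sup>2 / s - y^4 / (4 * s^3) \<le> \<bar>y\<bar>" for y :: real
  proof -
    define z where "z = \<bar>y\<bar> / s"
    have z: "z \<ge> 0" "\<bar>y\<bar> = z * s" using s by (auto simp: z_def)
    have y2: "y\<^sup>2 = (z * s)\<^sup>2" using z(2) by (metis power2_abs)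
    hence y4: "y^4 = (z * s)^4" by (metis power2_abs power_even_abs_numeral even_numeral z(2))
    \<comment> \<open>On \<open>z \<ge> 0\<close> the cubic is smallest near \<open>6/5\<close>
      (exactly at \<open>2 / sqrt 3\<close>); splitting off a square there leaves only nonnegative
      terms.\<close>
    have "z * (z^3 - 4 * z + 4) = z * ((z - 6/5)\<^sup>2 * (z + 12/5) + 8/25 * z + 68/125)"
      by (simp add: power2_eq_square power3_eq_cube field_simps)
    also have "\<dots> \<ge> 0" using z by simp
    finally have "z\<^sup>2 - z^4 / 4 \<le> z"
      by (simp add: power2_eq_square power3_eq_cube power4_eq_xxxx algebra_simps)
    hence "(z\<^sup>2 - z^4 / 4) * s \<le> z * s" using s by (intro mult_right_mono) auto
    moreover have "(z\<^sup>2 - z^4 / 4) * s = y\<^sup>2 / s - y^4 / (4 * s^3)"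
      unfolding y2 y4 using s(1) by (simp add: field_simps power2_eq_square power3_eq_cube power4_eq_xxxx)
    ultimately show ?thesis using z by simp
  qed
  have "s / 4 * real (card (bits N)) = (s\<^sup>2 * real (card (bits N))) / s
      - (3 * (s\<^sup>2)\<^sup>2 * real (card (bits N))) / (4 * s^3)"
    using s(1) by (simp add: field_simps power2_eq_square power3_eq_cube)
  also have "\<dots> \<le> (\<Sum>x\<in>bits N. (coinsum Q x)\<^sup>2) / s - (\<Sum>x\<in>bits N. coinsum Q x ^ 4) / (4 * s^3)"
    using sum_coinsum_power4[OF assms(1)] sum_coinsum_power2[OF assms(1)] s
    by (intro diff_mono divide_right_mono) auto
  also have "\<dots> = (\<Sum>x\<in>bits N. (coinsum Q x)\<^sup>2 / s - coinsum Q x ^ 4 / (4 * s^3))"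
    by (simp add: sum_subtractf sum_divide_distrib)
  also have "\<dots> \<le> (\<Sum>x\<in>bits N. \<bar>coinsum Q x\<bar>)" by (intro sum_mono pt)
  finally show ?thesis by (simp add: s_def)
qed

section \<open>Entropy chain rule\<close>

text \<open>Applied to \<open>u = b * coin p x\<close> with \<open>b\<close> the conditional mean of \<open>coin p\<close>: the term
  \<open>1 / (1 + u)\<close> has conditional mean at most 1, so the right-hand side averages to at least
  \<open>b\<^sup>2 / 8\<close>, however close \<open>u\<close> is to \<open>-1\<close>.\<close>

lemma ln_one_plus_tilt:
  fixes u :: real
  assumes "u > -1" "u \<le> 1"
  shows "ln (1 + u) \<ge> u/4 - u\<^sup>2/8 + 3/4 - (3/4) / (1+u)"
proof -
  \<comment> \<open>\<open>1 + u/4\<close> stays above \<open>3/4\<close>, so its logarithm has a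
    quadratic expansion; the quotient of \<open>1 + u/4\<close> by \<open>1 + u\<close> is left to
    \<open>ln y \<le> y - 1\<close>.\<close>
  have "\<bar>ln (1 + u/4) - u/4\<bar> \<le> 2 * (u/4)\<^sup>2"
    using assms by (intro abs_ln_one_plus_x_minus_x_bound) auto
  hence 1: "ln (1 + u/4) \<ge> u/4 - u\<^sup>2/8" 
  proof -
    have "2 * (u/4)\<^sup>2 = u\<^sup>2/8" by (simp add: power_divide)
    with \<open>\<bar>ln (1 + u/4) - u/4\<bar> \<le> 2 * (u/4)\<^sup>2\<close> show ?thesis by linarith
  qed
  have "ln ((1 + u/4) / (1+u)) \<le> (1 + u/4) / (1+u) - 1"
    using assms by (intro ln_le_minus_one) auto
  also have "(1 + u/4) / (1+u) - 1 = (3/4) / (1+u) - 3/4"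
    using assms by (simp add: field_simps)
  finally have "ln (1 + u/4) - ln (1+u) \<le> (3/4) / (1+u) - 3/4"
    using assms by (simp add: ln_div)
  with 1 show ?thesis by linarith
qed

text \<open>The sum of \<open>ln (c q x)\<close> over all \<open>x\<close>, divided by the number of inputs, is the entropy of the
  bits from position \<open>q\<close> on, conditioned on the earlier bits and on \<open>W\<close>.\<close>

lemma sum_bias_step:
  fixes W :: "bool list \<Rightarrow> 'c"
  assumes "p < N"
  defines "\<kappa> \<equiv> \<lambda>q x. (take q x, W x)"
  defines "c \<equiv> \<lambda>q x. real (card {y \<in> bits N. \<kappa> q y = \<kappa> q x})"
  shows "(\<Sum>x\<in>bits N. (cavg (bits N) (\<kappa> p) (coin p) x)\<^sup>2) / 8 \<le>
    (\<Sum>x\<in>bits N. ln 2 - ln (c p x) + ln (c (Suc p) x))"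
proof -
  let ?A = "bits N" and ?b = "cavg (bits N) (\<kappa> p) (coin p)"
  let ?C = "\<lambda>q x. {y \<in> bits N. \<kappa> q y = \<kappa> q x}"
  have cpos: "c q x > 0" if "x \<in> ?A" for q x
    using that unfolding c_def by (auto simp: card_gt_0_iff)
  have sub: "?C (Suc p) x = {y \<in> ?C p x. y ! p = x ! p}" if "x \<in> ?A" for x
    using that assms by (auto simp: \<kappa>_def bits_def take_Suc_conv_app_nth)
  \<comment> \<open>A class of \<open>\<kappa> p\<close> splits into at most two classes of
    \<open>\<kappa> (Suc p)\<close> according to bit \<open>p\<close>; both sides are twice the
    conditional probability of the bit that \<open>x\<close> has.\<close>
  have half: "1 + ?b x * coin p x = 2 * c (Suc p) x / c p x" if x: "x \<in> ?A" for x
  proof -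
    have "c p x * (1 + ?b x * coin p x) = (\<Sum>y\<in>?C p x. 1 + coin p y * coin p x)"
    proof -
      have "c p x * ?b x = (\<Sum>y\<in>?C p x. coin p y)"
      proof -
        have "?b x = (\<Sum>y\<in>?C p x. coin p y) / c p x" by (simp only: cavg_def c_def)
        thus ?thesis using cpos[OF x, of p] by simp
      qed
      hence "c p x * (1 + ?b x * coin p x) = c p x + (\<Sum>y\<in>?C p x. coin p y) * coin p x"
        by (simp add: distrib_left mult.assoc[symmetric])
      also have "\<dots> = (\<Sum>y\<in>?C p x. 1 + coin p y * coin p x)"
        by (simp only: sum.distrib sum_distrib_right) (simp add: c_def)
      finally show ?thesis .
    qed
    also have "\<dots> = (\<Sum>y\<in>?C p x. if y ! p = x ! p then 2 else 0)"
      by (intro sum.cong refl) (auto simp: coin_def bitval_def)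
    also have "\<dots> = 2 * c (Suc p) x"
      by (subst sum.inter_filter[symmetric]) (simp_all add: c_def sub[OF x])
    finally show ?thesis using cpos[OF x, of p] by (simp add: field_simps)
  qed
  have inv: "(\<Sum>x\<in>?A. 1 / (1 + ?b x * coin p x)) \<le> real (card ?A)"
  proof -
    \<comment> \<open>Each nonempty half of a class contributes 1; an empty half contributes 0,
      hence only \<open>\<le>\<close>.\<close>
    have cl: "(\<Sum>x\<in>?C p y. 1 / c (Suc p) x) \<le> 2" if y: "y \<in> ?A" for y
    proof -
      have *: "(\<Sum>x\<in>{x \<in> ?C p y. x ! p = v}. 1 / c (Suc p) x) \<le> 1" for v
      proof -
        have "c (Suc p) x = real (card {x \<in> ?C p y. x ! p = v})"
          if "x \<in> {x \<in> ?C p y. x ! p = v}" for x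
        proof -
          have "?C p x = ?C p y" using that by auto
          then show ?thesis using that sub[of x] unfolding c_def by auto
        qed
        hence "(\<Sum>x\<in>{x \<in> ?C p y. x ! p = v}. 1 / c (Suc p) x) =
            (\<Sum>x\<in>{x \<in> ?C p y. x ! p = v}. 1 / real (card {x \<in> ?C p y. x ! p = v}))"
          by (intro sum.cong refl) simp
        also have "\<dots> \<le> 1" by simp
        finally show ?thesis .
      qed
      have "?C p y = {x \<in> ?C p y. x ! p = True} \<union> {x \<in> ?C p y. x ! p = False}" by auto
      hence "(\<Sum>x\<in>?C p y. 1 / c (Suc p) x) =
          (\<Sum>x\<in>{x \<in> ?C p y. x ! p = True} \<union> {x \<in> ?C p y. x ! p = False}. 1 / c (Suc p) x)"
        by (rule sum.cong[OF _ refl])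
      also have "\<dots> = (\<Sum>x\<in>{x \<in> ?C p y. x ! p = True}. 1 / c (Suc p) x) +
          (\<Sum>x\<in>{x \<in> ?C p y. x ! p = False}. 1 / c (Suc p) x)"
        by (rule sum.union_disjoint) auto
      finally show ?thesis using *[of True] *[of False] by linarith
    qed
    have "(\<Sum>x\<in>?A. 1 / (1 + ?b x * coin p x)) = (\<Sum>x\<in>?A. (c p x / c (Suc p) x) / 2)"
      by (intro sum.cong refl) (simp add: half)
    also have "\<dots> = (\<Sum>x\<in>?A. \<Sum>y\<in>?C p x. 1 / c (Suc p) x) / 2"
      by (simp add: c_def sum_divide_distrib)
    also have "(\<Sum>x\<in>?A. \<Sum>y\<in>?C p x. 1 / c (Suc p) x) = (\<Sum>y\<in>?A. \<Sum>x\<in>?C p y. 1 / c (Suc p) x)"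
      by (subst sum.swap_restrict) (auto intro!: sum.cong)
    also have "\<dots> \<le> (\<Sum>y\<in>?A. 2)" by (intro sum_mono cl)
    finally show ?thesis by simp
  qed
  have pt: "ln 2 - ln (c p x) + ln (c (Suc p) x) \<ge>
      (coin p x * ?b x) / 4 - (?b x)\<^sup>2 / 8 + 3/4 - (3/4) * (1 / (1 + ?b x * coin p x))"
    if x: "x \<in> ?A" for x
  proof -
    let ?u = "?b x * coin p x"
    have gt: "1 + ?u > 0" using half[OF x] cpos[OF x] by simp
    have "c (Suc p) x \<le> c p x"
      unfolding c_def sub[OF x] by (intro of_nat_mono card_mono) auto
    hence "2 * c (Suc p) x / c p x \<le> 2" using cpos[OF x, of p] by (simp add: divide_le_eq)
    hence le: "?u \<le> 1" using half[OF x] by linarith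
    have "ln (1 + ?u) = ln 2 - ln (c p x) + ln (c (Suc p) x)"
      using cpos[OF x, of p] cpos[OF x, of "Suc p"] by (simp add: half[OF x] ln_div ln_mult)
    moreover have "?u\<^sup>2 = (?b x)\<^sup>2" by (simp add: power_mult_distrib)
    ultimately show ?thesis using ln_one_plus_tilt[of ?u] gt le by (simp add: mult.commute)
  qed
  have "(\<Sum>x\<in>?A. (?b x)\<^sup>2) = (\<Sum>x\<in>?A. coin p x * ?b x)"
    by (rule sum_cavg_power2) simp
  hence "(\<Sum>x\<in>?A. (?b x)\<^sup>2) / 8 = (\<Sum>x\<in>?A. coin p x * ?b x) / 4 - (\<Sum>x\<in>?A. (?b x)\<^sup>2) / 8"
    by simp
  also have "\<dots> \<le> (\<Sum>x\<in>?A. coin p x * ?b x) / 4 - (\<Sum>x\<in>?A. (?b x)\<^sup>2) / 8 +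
      (3/4) * (real (card ?A) - (\<Sum>x\<in>?A. 1 / (1 + ?b x * coin p x)))"
    using inv by simp
  also have "\<dots> = (\<Sum>x\<in>?A. (coin p x * ?b x) / 4 - (?b x)\<^sup>2 / 8 + 3/4 -
      (3/4) * (1 / (1 + ?b x * coin p x)))"
    by (simp only: sum_subtractf sum.distrib sum_divide_distrib[symmetric] sum_distrib_left[symmetric])
       (simp add: algebra_simps)
  also have "\<dots> \<le> (\<Sum>x\<in>?A. ln 2 - ln (c p x) + ln (c (Suc p) x))"
    by (intro sum_mono pt)
  finally show ?thesis .
qed

text \<open>Summing the bounds for single bits telescopes to the entropy of the input minus its
  entropy given \<open>W\<close>. This is the entropy of \<open>W\<close>, at most
  \<open>ln (card B)\<close>.\<close>

lemma sum_bias_le: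
  fixes W :: "bool list \<Rightarrow> 'c"
  assumes "finite B" "W ` bits N \<subseteq> B"
  shows "(\<Sum>p<N. \<Sum>x\<in>bits N. (cavg (bits N) (\<lambda>x. (take p x, W x)) (coin p) x)\<^sup>2)
    \<le> 8 * real (card (bits N)) * ln (real (card B))"
proof -
  let ?A = "bits N"
  define c where "c q x = real (card {y \<in> ?A. (take q y, W y) = (take q x, W x)})" for q x
  define c0 where "c0 w = real (card {y \<in> ?A. W y = w})" for w
  have ne: "?A \<noteq> {}" using card_bits[of N] by (metis card.empty power_not_zero zero_neq_numeral)
  have Bpos: "real (card B) > 0" using assms ne by (auto simp: card_gt_0_iff)
  have "(\<Sum>p<N. \<Sum>x\<in>?A. (cavg ?A (\<lambda>x. (take p x, W x)) (coin p) x)\<^sup>2) / 8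
      = (\<Sum>p<N. (\<Sum>x\<in>?A. (cavg ?A (\<lambda>x. (take p x, W x)) (coin p) x)\<^sup>2) / 8)"
    by (simp add: sum_divide_distrib)
  also have "\<dots> \<le> (\<Sum>p<N. \<Sum>x\<in>?A. ln 2 - ln (c p x) + ln (c (Suc p) x))"
    unfolding c_def by (intro sum_mono sum_bias_step) auto
  also have "\<dots> = (\<Sum>x\<in>?A. \<Sum>p<N. ln 2 + (ln (c (Suc p) x) - ln (c p x)))"
    by (subst sum.swap) (simp add: algebra_simps)
  also have "\<dots> = (\<Sum>x\<in>?A. real N * ln 2 + (ln (c N x) - ln (c 0 x)))"
    by (intro sum.cong refl) (simp add: sum.distrib sum_lessThan_telescope[of "\<lambda>p. ln (c p _)"])
  also have "\<dots> = (\<Sum>x\<in>?A. ln (real (card ?A) / c0 (W x)))"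
  proof (intro sum.cong refl)
    fix x assume x: "x \<in> ?A"
    have "{y \<in> ?A. (take N y, W y) = (take N x, W x)} = {x}"
      using x by (auto simp: bits_def)
    hence "c N x = 1" by (simp add: c_def)
    moreover have "c 0 x = c0 (W x)" by (simp add: c_def c0_def)
    moreover have "c0 (W x) > 0" using x by (auto simp: c0_def card_gt_0_iff)
    ultimately show "real N * ln 2 + (ln (c N x) - ln (c 0 x)) = ln (real (card ?A) / c0 (W x))"
      by (simp add: ln_div ln_realpow)
  qed
  \<comment> \<open>This is \<open>ln y \<le> y - 1\<close> for the ratio \<open>y\<close> of the
    uniform probability on \<open>B\<close> to the probability of \<open>W x\<close>; the ratio has
    mean at most 1.\<close>
  also have "\<dots> \<le> (\<Sum>x\<in>?A. ln (real (card B)) + (real (card ?A) / (c0 (W x) * real (card B)) - 1))"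
  proof (intro sum_mono)
    fix x assume x: "x \<in> ?A"
    have pos: "c0 (W x) > 0" using x by (auto simp: c0_def card_gt_0_iff)
    let ?y = "real (card ?A) / (c0 (W x) * real (card B))"
    have "ln ?y \<le> ?y - 1" using pos Bpos by (intro ln_le_minus_one) simp
    moreover have "ln (real (card ?A) / c0 (W x)) = ln (real (card B)) + ln ?y"
      using pos Bpos by (simp add: ln_div ln_mult)
    ultimately show "ln (real (card ?A) / c0 (W x)) \<le> ln (real (card B)) + (?y - 1)" by linarith
  qed
  also have "\<dots> = real (card ?A) * ln (real (card B)) +
      (real (card ?A) / real (card B) * (\<Sum>x\<in>?A. 1 / c0 (W x)) - real (card ?A))"
    by (simp add: sum.distrib sum_subtractf sum_distrib_left mult.commute[of _ "real (card B)"]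
        del: card_bits)
  also have "(\<Sum>x\<in>?A. 1 / c0 (W x)) \<le> real (card B)"
  proof -
    have "(\<Sum>x\<in>?A. 1 / c0 (W x)) = (\<Sum>w\<in>B. \<Sum>x | x \<in> ?A \<and> W x = w. 1 / c0 (W x))"
      using assms by (intro sum.group[symmetric]) auto
    also have "\<dots> \<le> (\<Sum>w\<in>B. 1)"
    proof (intro sum_mono)
      fix w
      have "(\<Sum>x | x \<in> ?A \<and> W x = w. 1 / c0 (W x)) = (\<Sum>x | x \<in> ?A \<and> W x = w. 1 / c0 w)"
        by (intro sum.cong) auto
      also have "\<dots> \<le> 1" by (simp add: c0_def)
      finally show "(\<Sum>x | x \<in> ?A \<and> W x = w. 1 / c0 (W x)) \<le> 1" .
    qed
    finally show ?thesis by simp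
  qed
  hence "real (card ?A) * ln (real (card B)) +
      (real (card ?A) / real (card B) * (\<Sum>x\<in>?A. 1 / c0 (W x)) - real (card ?A))
      \<le> real (card ?A) * ln (real (card B))"
    using Bpos by (simp add: field_simps)
  finally show ?thesis by simp
qed

section \<open>Multi-pass algorithms\<close>

definition mix :: "nat \<Rightarrow> nat \<Rightarrow> bool list \<Rightarrow> bool list \<Rightarrow> bool list" where
  "mix a b x y = map (\<lambda>i. if a \<le> i \<and> i < b then y ! i else x ! i) [0..<length x]"

lemma length_mix [simp]: "length (mix a b x y) = length x"
  by (simp add: mix_def)

lemma nth_mix: "i < length x \<Longrightarrow> mix a b x y ! i = (if a \<le> i \<and> i < b then y ! i else x ! i)"
  by (simp add: mix_def)

lemma mix_in_bits [simp]: "x \<in> bits N \<Longrightarrow> mix a b x y \<in> bits N"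
  by (simp add: bits_def)

lemma mix_mix:
  assumes "x \<in> bits N" "y \<in> bits N"
  shows "mix a b (mix a b x y) (mix a b y x) = x"
  using assms by (intro nth_equalityI) (auto simp: nth_mix bits_def)

lemma coinsum_mix_outside:
  assumes "x \<in> bits N" "Q \<subseteq> {..<N}" "Q \<inter> {a..<b} = {}"
  shows "coinsum Q (mix a b x y) = coinsum Q x"
  unfolding coinsum_def coin_def
proof (intro sum.cong refl)
  fix p assume "p \<in> Q"
  hence "p < length x" "\<not> (a \<le> p \<and> p < b)" using assms by (auto simp: bits_def)
  thus "real_of_int (bitval (mix a b x y ! p)) = real_of_int (bitval (x ! p))"
    by (auto simp: nth_mix)
qed

lemma coinsum_mix_inside:
  assumes "x \<in> bits N" "Q \<subseteq> {a..<b}" "b \<le> N"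
  shows "coinsum Q (mix a b x y) = coinsum Q y"
  unfolding coinsum_def coin_def
proof (intro sum.cong refl)
  fix p assume "p \<in> Q"
  hence "p < length x" "a \<le> p \<and> p < b" using assms by (auto simp: bits_def)
  thus "real_of_int (bitval (mix a b x y ! p)) = real_of_int (bitval (y ! p))"
    by (auto simp: nth_mix)
qed

text \<open>An algorithm with its seed fixed. The stream index of an update is a function of the
  position, so it is absorbed into \<open>f\<close>.\<close>

locale multipass =
  fixes f :: "nat \<Rightarrow> nat \<Rightarrow> bool \<Rightarrow> nat \<Rightarrow> nat" and init k N :: nat
begin

definition seg :: "nat \<Rightarrow> bool list \<Rightarrow> nat \<Rightarrow> nat \<Rightarrow> nat" where
  "seg p x \<sigma> l = fold (\<lambda>i. f p i (x ! i)) [0..<l] \<sigma>"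

primrec start :: "bool list \<Rightarrow> nat \<Rightarrow> nat" where
  "start x 0 = init"
| "start x (Suc p) = seg p x (start x p) N"

definition mem :: "nat \<Rightarrow> bool list \<Rightarrow> nat list" where
  "mem l x = map (\<lambda>p. seg p x (start x p) l) [0..<k]"

lemma seg_0 [simp]: "seg p x \<sigma> 0 = \<sigma>"
  by (simp add: seg_def)

lemma seg_Suc [simp]: "seg p x \<sigma> (Suc l) = f p l (x ! l) (seg p x \<sigma> l)"
  by (simp add: seg_def)

lemma seg_cong:
  assumes "a \<le> l" "seg p x \<sigma> a = seg p y \<tau> a" "\<And>i. a \<le> i \<Longrightarrow> i < l \<Longrightarrow> x ! i = y ! i"
  shows "seg p x \<sigma> l = seg p y \<tau> l"
  using assms by (induction l rule: dec_induct) auto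

lemma mem_eq_iff:
  "mem l x = mem l' y \<longleftrightarrow> (\<forall>p<k. seg p x (start x p) l = seg p y (start y p) l')"
  by (auto simp: mem_def)

text \<open>Each pass starts in the end state of the previous one, so \<open>mem N\<close> fixes all
  start states; from there the first \<open>a\<close> bits determine the states at
  \<open>a\<close>.\<close>

lemma mem_prefix:
  assumes "mem N x = mem N y" "\<And>i. i < a \<Longrightarrow> x ! i = y ! i"
  shows "mem a x = mem a y"
  unfolding mem_eq_iff
proof (intro allI impI)
  fix p assume p: "p < k"
  have eq: "start x p = start y p"
  proof (cases p)
    case (Suc q)
    thus ?thesis using assms(1)[unfolded mem_eq_iff, rule_format, of q] p by simp
  qed simp
  show "seg p x (start x p) a = seg p y (start y p) a"
    by (rule seg_cong[of 0]) (simp_all add: eq assms(2))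
qed

text \<open>The cut-and-paste property of communication protocols, for the two parties that hold the
  bits inside and outside of \<open>{a..<b}\<close>.\<close>

lemma mem_mix:
  assumes x: "x \<in> bits N" and ab: "a \<le> b" "b \<le> N"
    and a: "mem a x = mem a y" and b: "mem b x = mem b y" and l: "l \<le> a \<or> b \<le> l" "l \<le> N"
  shows "mem l (mix a b x y) = mem l x"
proof -
  let ?z = "mix a b x y"
  have nth: "?z ! i = (if a \<le> i \<and> i < b then y ! i else x ! i)" if "i < N" for i
    using that x by (simp add: nth_mix bits_def)
  have key: "seg p ?z (start x p) l = seg p x (start x p) l"
    if p: "p < k" and l: "l \<le> a \<or> b \<le> l" "l \<le> N" for p l
  proof -
    have 1: "seg p ?z (start x p) l = seg p x (start x p) l" if "l \<le> a" for l
      by (rule seg_cong[of 0]) (use that ab in \<open>auto simp: nth\<close>)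
    \<comment> \<open>Up to \<open>a\<close> the mixed run is that of \<open>x\<close>; at
      \<open>a\<close> it agrees with the run of \<open>y\<close>, which it follows up to
      \<open>b\<close>. There it is back on the run of \<open>x\<close>, even if the start states of
      \<open>x\<close> and \<open>y\<close> differ.\<close>
    have "seg p ?z (start x p) b = seg p y (start y p) b"
    proof (rule seg_cong[of a])
      show "seg p ?z (start x p) a = seg p y (start y p) a"
        using 1[of a] a p by (simp add: mem_eq_iff)
    qed (use ab in \<open>auto simp: nth\<close>)
    hence 2: "seg p ?z (start x p) b = seg p x (start x p) b"
      using b p by (simp add: mem_eq_iff)
    show ?thesis
    proof (cases "l \<le> a")
      case False
      show ?thesis by (rule seg_cong[of b]) (use False l 2 in \<open>auto simp: nth\<close>)
    qed (use 1 in auto)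
  qed
  have "start ?z p = start x p" if "p \<le> k" for p
    using that by (induction p) (use key ab in auto)
  thus ?thesis using key l by (simp add: mem_eq_iff)
qed

section \<open>Conditional means of block sums\<close>

definition block_avg :: "nat set \<Rightarrow> nat \<Rightarrow> nat \<Rightarrow> bool list \<Rightarrow> real" where
  "block_avg Q a b = cavg (bits N) (\<lambda>x. (mem a x, mem b x)) (coinsum Q)"

text \<open>The transplant of \<open>{a..<b}\<close> is an exchange in the sense of
  \<open>sum_cavg_exchange\<close>, so \<open>h\<close> may depend on all bits outside the window
  and not only on the memory at its two ends.\<close>

lemma block_avg_exchange:
  assumes "a \<le> b" "b \<le> N" "Q \<subseteq> {a..<b}"
    and h: "\<And>x y. x \<in> bits N \<Longrightarrow> y \<in> bits N \<Longrightarrow> mem a x = mem a y \<Longrightarrow> mem b x = mem b y \<Longrightarrow>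
      h (mix a b x y) = h x"
  shows "(\<Sum>x\<in>bits N. coinsum Q x * h x) = (\<Sum>x\<in>bits N. block_avg Q a b x * h x)"
  unfolding block_avg_def
proof (rule sum_cavg_exchange[where mx = "mix a b"])
  fix x y assume xy: "x \<in> bits N" "y \<in> bits N" "(mem a x, mem b x) = (mem a y, mem b y)"
  show "mix a b x y \<in> bits N \<and> (mem a (mix a b x y), mem b (mix a b x y)) = (mem a x, mem b x) \<and>
    h (mix a b x y) = h x \<and> coinsum Q (mix a b x y) = coinsum Q y \<and>
    mix a b (mix a b x y) (mix a b y x) = x"
    using xy assms mem_mix[OF xy(1) assms(1,2), of y]
    by (auto simp: mix_mix coinsum_mix_inside)
qed simp

lemma block_avg_mix:
  assumes "x \<in> bits N" "a \<le> b" "b \<le> N" "mem a x = mem a y" "mem b x = mem b y"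
    and "c \<le> d" "d \<le> N" "d \<le> a \<or> b \<le> c"
  shows "block_avg Q c d (mix a b x y) = block_avg Q c d x"
proof -
  have "mem c (mix a b x y) = mem c x" "mem d (mix a b x y) = mem d x"
    using assms by (auto intro!: mem_mix)
  thus ?thesis unfolding block_avg_def by (intro cavg_cong_class) simp
qed

text \<open>Replace the first factor by the raw sum over \<open>Q\<close>, as the later mean ignores
  transplants inside \<open>{a..<b}\<close>; then replace the second, as the sum over
  \<open>Q\<close> ignores those inside \<open>{c..<d}\<close>. Disjoint sets of coins are
  uncorrelated.\<close>

lemma block_avg_orthogonal:
  assumes "a \<le> b" "b \<le> c" "c \<le> d" "d \<le> N" "Q \<subseteq> {a..<b}" "R \<subseteq> {c..<d}"
  shows "(\<Sum>x\<in>bits N. block_avg Q a b x * block_avg R c d x) = 0"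
proof -
  have "(\<Sum>x\<in>bits N. block_avg Q a b x * block_avg R c d x)
      = (\<Sum>x\<in>bits N. coinsum Q x * block_avg R c d x)"
    using assms by (intro block_avg_exchange[symmetric]) (auto intro!: block_avg_mix)
  also have "\<dots> = (\<Sum>x\<in>bits N. block_avg R c d x * coinsum Q x)"
    by (simp add: mult.commute)
  also have "\<dots> = (\<Sum>x\<in>bits N. coinsum R x * coinsum Q x)"
    using assms by (intro block_avg_exchange[symmetric]) (auto intro!: coinsum_mix_outside)
  also have "\<dots> = 0"
  proof (rule sum_coinsum_mult_disjoint)
    have "p < q" if "p \<in> Q" "q \<in> R" for p q
      using that assms by (meson atLeastLessThan_iff order_less_le_trans order_trans subsetD)
    thus "R \<inter> Q = {}" by blast
  qed (use assms in auto)
  finally show ?thesis .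
qed

lemma sum_block_avg_power2:
  assumes bd: "mono bd" "\<And>i. bd i \<le> N" and Q: "\<And>i. Q i \<subseteq> {bd i..<bd (Suc i)}"
  shows "(\<Sum>x\<in>bits N. (\<Sum>i<B. block_avg (Q i) (bd i) (bd (Suc i)) x)\<^sup>2)
    = (\<Sum>i<B. \<Sum>x\<in>bits N. (block_avg (Q i) (bd i) (bd (Suc i)) x)\<^sup>2)"
proof (induction B)
  case (Suc B)
  let ?E = "\<lambda>i. block_avg (Q i) (bd i) (bd (Suc i))"
  have mono: "bd i \<le> bd j" if "i \<le> j" for i j using bd(1) that by (simp add: monoD)
  have "(\<Sum>x\<in>bits N. (\<Sum>i<B. ?E i x) * ?E B x) = (\<Sum>i<B. \<Sum>x\<in>bits N. ?E i x * ?E B x)"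
    by (subst sum.swap) (simp add: sum_distrib_right)
  also have "\<dots> = 0"
  proof (rule sum.neutral, rule ballI)
    fix i assume "i \<in> {..<B}"
    thus "(\<Sum>x\<in>bits N. ?E i x * ?E B x) = 0"
      by (intro block_avg_orthogonal mono bd Q) auto
  qed
  finally have "(\<Sum>x\<in>bits N. (\<Sum>i<B. ?E i x) * ?E B x) = 0" .
  moreover have "(\<Sum>x\<in>bits N. (\<Sum>i<Suc B. ?E i x)\<^sup>2) = (\<Sum>x\<in>bits N. (\<Sum>i<B. ?E i x)\<^sup>2)
      + 2 * (\<Sum>x\<in>bits N. (\<Sum>i<B. ?E i x) * ?E B x) + (\<Sum>x\<in>bits N. (?E B x)\<^sup>2)"
    by (simp add: power2_sum sum.distrib sum_distrib_left algebra_simps)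
  ultimately show ?case using Suc by simp
qed simp

text \<open>A function \<open>g\<close> of the final memory ignores transplants, so each block sum
  may be replaced by its conditional mean. AM-GM and orthogonality then turn the correlation into
  second moments.\<close>

lemma sum_coinsum_mult_output_le:
  assumes bd: "mono bd" "\<And>i. bd i \<le> N" and Q: "\<And>i. Q i \<subseteq> {bd i..<bd (Suc i)}"
    and g: "\<And>x y. x \<in> bits N \<Longrightarrow> y \<in> bits N \<Longrightarrow> mem N x = mem N y \<Longrightarrow> g x = g y"
    and g1: "\<And>x. \<bar>g x\<bar> \<le> (1 :: real)" and s: "s > 0"
  shows "(\<Sum>x\<in>bits N. (\<Sum>i<B. coinsum (Q i) x) * g x) \<le> s / 16 * real (card (bits N)) +
    4 / s * (\<Sum>i<B. \<Sum>x\<in>bits N. (block_avg (Q i) (bd i) (bd (Suc i)) x)\<^sup>2)"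
proof -
  let ?E = "\<lambda>i. block_avg (Q i) (bd i) (bd (Suc i))"
  have mono: "bd i \<le> bd j" if "i \<le> j" for i j using bd(1) that by (simp add: monoD)
  have "(\<Sum>x\<in>bits N. (\<Sum>i<B. coinsum (Q i) x) * g x) = (\<Sum>i<B. \<Sum>x\<in>bits N. coinsum (Q i) x * g x)"
    by (subst sum.swap) (simp add: sum_distrib_right)
  also have "\<dots> = (\<Sum>i<B. \<Sum>x\<in>bits N. ?E i x * g x)"
  proof (rule sum.cong[OF refl], rule block_avg_exchange)
    fix i x y assume "x \<in> bits N" "y \<in> bits N" "mem (bd i) x = mem (bd i) y"
      "mem (bd (Suc i)) x = mem (bd (Suc i)) y"
    thus "g (mix (bd i) (bd (Suc i)) x y) = g x"
      using bd mono by (intro g mem_mix) auto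
  qed (use bd mono Q in auto)
  also have "\<dots> = (\<Sum>x\<in>bits N. (\<Sum>i<B. ?E i x) * g x)"
    by (subst sum.swap) (simp add: sum_distrib_right)
  also have "\<dots> \<le> (\<Sum>x\<in>bits N. s / 16 + 4 / s * (\<Sum>i<B. ?E i x)\<^sup>2)"
  proof (intro sum_mono)
    fix x
    let ?e = "\<Sum>i<B. ?E i x"
    have "\<bar>?e * g x\<bar> \<le> \<bar>?e\<bar> * 1"
      unfolding abs_mult by (intro mult_left_mono g1) simp
    hence "?e * g x \<le> \<bar>?e\<bar>" by simp
    \<comment> \<open>The weights make the loss \<open>s / 16\<close> half of the correlation
      \<open>s / 8\<close> that \<open>sum_output_ge\<close> provides for
      \<open>s = sqrt n\<close>.\<close>
    moreover have "0 \<le> (s / 8 - \<bar>?e\<bar>)\<^sup>2 * (4 / s)" using s by simp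
    moreover have "(s / 8 - \<bar>?e\<bar>)\<^sup>2 * (4 / s) = s / 16 - \<bar>?e\<bar> + 4 / s * ?e\<^sup>2"
      using s by (simp add: power2_diff field_simps power2_eq_square)
    ultimately show "?e * g x \<le> s / 16 + 4 / s * ?e\<^sup>2" by linarith
  qed
  also have "\<dots> = s / 16 * real (card (bits N)) + 4 / s * (\<Sum>x\<in>bits N. (\<Sum>i<B. ?E i x)\<^sup>2)"
    by (simp add: sum.distrib sum_distrib_left)
  also have "(\<Sum>x\<in>bits N. (\<Sum>i<B. ?E i x)\<^sup>2) = (\<Sum>i<B. \<Sum>x\<in>bits N. (?E i x)\<^sup>2)"
    by (rule sum_block_avg_power2[OF assms(1-3)])
  finally show ?thesis .
qed

section \<open>Revealing the bits one by one\<close>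

definition bias :: "nat \<Rightarrow> nat \<Rightarrow> bool list \<Rightarrow> real" where
  "bias T p = cavg (bits N) (\<lambda>x. (take p x, mem N x, mem T x)) (coin p)"

text \<open>For \<open>p \<ge> a\<close>, \<open>take p x\<close> and \<open>mem N x\<close>
  determine \<open>mem a x\<close>. So the block mean is a function of what \<open>bias T p\<close>
  conditions on, and against it each coin may be replaced by its bias; Cauchy-Schwarz finishes. As
  \<open>bias\<close> does not mention \<open>a\<close>, the same biases serve all windows that end
  at \<open>T\<close>.\<close>

lemma sum_block_avg_power2_le_bias:
  assumes "a \<le> T" "T \<le> N" "Q \<subseteq> {a..<T}"
  shows "(\<Sum>x\<in>bits N. (block_avg Q a T x)\<^sup>2) \<le>
    real (card Q) * (\<Sum>p\<in>Q. \<Sum>x\<in>bits N. (bias T p x)\<^sup>2)"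
proof -
  let ?e = "block_avg Q a T"
  have "(\<Sum>x\<in>bits N. (?e x)\<^sup>2) = (\<Sum>x\<in>bits N. coinsum Q x * ?e x)"
    unfolding block_avg_def by (rule sum_cavg_power2) simp
  also have "\<dots> = (\<Sum>p\<in>Q. \<Sum>x\<in>bits N. coin p x * ?e x)"
    by (subst sum.swap) (simp add: coinsum_def sum_distrib_right)
  also have "\<dots> = (\<Sum>p\<in>Q. \<Sum>x\<in>bits N. bias T p x * ?e x)"
  proof (rule sum.cong[OF refl])
    fix p assume "p \<in> Q"
    hence p: "a \<le> p" using assms by auto
    show "(\<Sum>x\<in>bits N. coin p x * ?e x) = (\<Sum>x\<in>bits N. bias T p x * ?e x)"
      unfolding bias_def
    proof (rule sum_cavg_mult)
      fix x y assume xy: "x \<in> bits N" "y \<in> bits N"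
        "(take p x, mem N x, mem T x) = (take p y, mem N y, mem T y)"
      hence eq: "take p x = take p y" "mem N x = mem N y" "mem T x = mem T y" by auto
      have "x ! i = y ! i" if "i < a" for i
        using that p nth_take[of i p x] nth_take[of i p y] eq(1) by simp
      hence "mem a x = mem a y" by (rule mem_prefix[OF eq(2)])
      thus "?e x = ?e y" unfolding block_avg_def by (intro cavg_cong_class) (simp add: eq(3))
    qed simp
  qed
  also have "\<dots> = (\<Sum>x\<in>bits N. (\<Sum>p\<in>Q. bias T p x) * ?e x)"
    by (subst sum.swap) (simp add: sum_distrib_right)
  finally have "(\<Sum>x\<in>bits N. (?e x)\<^sup>2) \<le> (\<Sum>x\<in>bits N. (\<Sum>p\<in>Q. bias T p x)\<^sup>2)"
    by (rule sum_power2_le_of_cross)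
  also have "\<dots> \<le> (\<Sum>x\<in>bits N. (\<Sum>p\<in>Q. (bias T p x)\<^sup>2) * real (card Q))"
    by (intro sum_mono sum_squared_le_sum_of_squares)
  also have "\<dots> = real (card Q) * (\<Sum>p\<in>Q. \<Sum>x\<in>bits N. (bias T p x)\<^sup>2)"
    by (subst sum.swap) (simp add: sum_distrib_left sum_distrib_right mult.commute)
  finally show ?thesis .
qed

lemma mem_bounded:
  assumes "init < 2 ^ s" "\<And>p l b \<sigma>. p < k \<Longrightarrow> l < N \<Longrightarrow> \<sigma> < 2 ^ s \<Longrightarrow> f p l b \<sigma> < 2 ^ s" "l \<le> N"
  shows "mem l x \<in> {xs. set xs \<subseteq> {..<2 ^ s} \<and> length xs = k}"
proof -
  have seg: "seg p x \<sigma> l < 2 ^ s" if "p < k" "\<sigma> < 2 ^ s" "l \<le> N" for p \<sigma> l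
    using that(3) by (induction l) (use that assms in auto)
  have "start x p < 2 ^ s" if "p \<le> k" for p
    using that by (induction p) (use assms seg in auto)
  thus ?thesis using seg assms(3) by (auto simp: mem_def)
qed

text \<open>The pair of memories at \<open>N\<close> and \<open>T\<close> takes at most
  \<open>2 ^ (2 * k * s)\<close> values.\<close>

lemma sum_bias_le_memory:
  assumes "init < 2 ^ s" "\<And>p l b \<sigma>. p < k \<Longrightarrow> l < N \<Longrightarrow> \<sigma> < 2 ^ s \<Longrightarrow> f p l b \<sigma> < 2 ^ s" "T \<le> N"
  shows "(\<Sum>p<N. \<Sum>x\<in>bits N. (bias T p x)\<^sup>2) \<le> 16 * real k * real s * real (card (bits N))"
proof -
  let ?M = "{xs :: nat list. set xs \<subseteq> {..<2 ^ s} \<and> length xs = k}"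
  have M: "finite ?M" "card ?M = (2 ^ s) ^ k"
    using finite_lists_length_eq[of "{..<2 ^ s :: nat}" k]
      card_lists_length_eq[of "{..<2 ^ s :: nat}" k] by auto
  have "(\<Sum>p<N. \<Sum>x\<in>bits N. (bias T p x)\<^sup>2)
      \<le> 8 * real (card (bits N)) * ln (real (card (?M \<times> ?M)))"
    unfolding bias_def using M mem_bounded[OF assms(1,2)] assms(3)
    by (intro sum_bias_le) auto
  also have "ln (real (card (?M \<times> ?M))) = 2 * (real k * (real s * ln 2))"
    by (simp add: card_cartesian_product M ln_mult ln_realpow del: power_mult)
  also have "\<dots> \<le> 2 * (real k * (real s * 1))"
    using ln_2_less_1 by (intro mult_left_mono) auto
  finally show ?thesis by (simp add: algebra_simps)
qed

end

section \<open>Interleaved streams\<close>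

text \<open>Positions in the interleaved input of the bits \<open>a..<b\<close> of one stream, with
  streams numbered from 0 as in \<open>majority\<close>.\<close>

definition spos :: "nat \<Rightarrow> nat \<Rightarrow> nat \<Rightarrow> nat \<Rightarrow> nat set" where
  "spos t j a b = (\<lambda>i. i * t + j) ` {a..<b}"

lemma spos_subset: "j < t \<Longrightarrow> spos t j a b \<subseteq> {a * t..<b * t}"
proof
  fix p assume "j < t" "p \<in> spos t j a b"
  then obtain i where i: "p = i * t + j" "a \<le> i" "i < b" by (auto simp: spos_def)
  have "a * t \<le> i * t + j" by (rule trans_le_add1) (intro mult_le_mono1 i)
  moreover have "Suc i * t \<le> b * t" using i by (intro mult_le_mono1) simp
  hence "i * t + j < b * t" using \<open>j < t\<close> by simp
  ultimately
  show "p \<in> {a * t..<b * t}" using i by simp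
qed

lemma card_spos: "t > 0 \<Longrightarrow> card (spos t j a b) = b - a"
  by (subst spos_def, subst card_image) (auto simp: inj_on_def)

lemma mem_spos_iff: "j < t \<Longrightarrow> p \<in> spos t j a b \<longleftrightarrow> p mod t = j \<and> a \<le> p div t \<and> p div t < b"
proof
  assume "j < t" "p mod t = j \<and> a \<le> p div t \<and> p div t < b"
  thus "p \<in> spos t j a b"
    unfolding spos_def by (intro image_eqI[of _ _ "p div t"]) auto
qed (auto simp: spos_def)

lemma coinsum_spos_split:
  assumes "t > 0" "a \<le> b" "b \<le> c"
  shows "coinsum (spos t j a c) x = coinsum (spos t j a b) x + coinsum (spos t j b c) x"
proof -
  have inj: "inj_on (\<lambda>i. i * t + j) S" for S using assms by (auto simp: inj_on_def)
  show ?thesis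
    unfolding coinsum_def spos_def using assms
    by (simp add: sum.reindex[OF inj] sum.atLeastLessThan_concat)
qed

lemma sum_coinsum_spos:
  assumes "t > 0" "mono \<beta>"
  shows "(\<Sum>i<B. coinsum (spos t j (\<beta> i) (\<beta> (Suc i))) x) = coinsum (spos t j (\<beta> 0) (\<beta> B)) x"
proof (induction B)
  case 0
  show ?case by (simp add: coinsum_def spos_def)
next
  case (Suc B)
  show ?case
    using Suc assms monoD[OF assms(2), of 0 B] monoD[OF assms(2), of B "Suc B"]
    by (simp add: coinsum_spos_split[of t "\<beta> 0" "\<beta> B" "\<beta> (Suc B)"])
qed

section \<open>Sliding windows and their scales\<close>

text \<open>Averaging over the offset \<open>r\<close> of a partition of \<open>{0..<n}\<close> into blocks of length \<open>m\<close> turns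
  a bound on partitions into a bound on sliding windows; truncated subtraction and \<open>min\<close> clip
  the blocks at both ends.\<close>

lemma sliding_window_ge:
  fixes G :: "nat \<Rightarrow> nat \<Rightarrow> real"
  assumes m: "1 \<le> m" "m \<le> n" and C: "C \<ge> 0"
    and G: "\<And>a b. a \<le> b \<Longrightarrow> b \<le> n \<Longrightarrow> G a b \<le> real (b - a) * C"
    and D: "\<And>r. r < m \<Longrightarrow> D \<le> (\<Sum>i<Suc n. G (min n (r + i * m - m)) (min n (r + i * m)))"
  shows "real m * D - 2 * real m * real (m - 1) * C \<le> (\<Sum>l=m..n. G (l - m) l)"
proof -
  let ?H = "\<lambda>l. G (min n (l - m)) (min n l)"
  define M where "M = Suc n * m"
  let ?R = "{..<m} \<union> {Suc n..<n + m}" and ?Z = "{n + m..<M}"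
  have nm: "n + m \<le> M" using m by (simp add: M_def)
  have "real m * D = (\<Sum>r<m. D)" by simp
  also have "\<dots> \<le> (\<Sum>r<m. \<Sum>i<Suc n. ?H (r + i * m))"
    by (intro sum_mono D) auto
  also have "\<dots> = (\<Sum>i<Suc n. \<Sum>r<m. ?H (r + i * m))" by (rule sum.swap)
  also have "\<dots> = (\<Sum>i<Suc n. sum ?H {i * m..<i * m + m})"
  proof (rule sum.cong[OF refl])
    fix i
    show "(\<Sum>r<m. ?H (r + i * m)) = sum ?H {i * m..<i * m + m}"
      using sum.shift_bounds_nat_ivl[of ?H 0 "i * m" m]
      by (simp add: lessThan_atLeast0 add.commute)
  qed
  also have "\<dots> = sum ?H {..<M}" unfolding M_def by (rule sum.nat_group)
  \<comment> \<open>The window ends \<open>r + i * m\<close> run once through all numbers below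
    \<open>M\<close>: those in \<open>{m..n}\<close> give full windows, those in \<open>?R\<close>
    windows clipped at one end of the stream, those in \<open>?Z\<close> empty ones.\<close>
  also have "{..<M} = {m..n} \<union> (?R \<union> ?Z)" using m nm by auto
  also have "sum ?H \<dots> = sum ?H {m..n} + (sum ?H ?R + sum ?H ?Z)"
    using m by (subst sum.union_disjoint; (subst sum.union_disjoint)?) auto
  also have "sum ?H {m..n} = (\<Sum>l=m..n. G (l - m) l)"
  proof (intro sum.cong refl)
    fix l assume "l \<in> {m..n}"
    hence "min n (l - m) = l - m" "min n l = l" by auto
    thus "?H l = G (l - m) l" by simp
  qed
  also have "sum ?H ?R \<le> (\<Sum>l\<in>?R. real (m - 1) * C)"
  proof (rule sum_mono)
    fix l assume l: "l \<in> ?R"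
    have "?H l \<le> real (min n l - min n (l - m)) * C" by (rule G) auto
    \<comment> \<open>A clipped window has fewer than \<open>m\<close> bits. With
      \<open>m - 1\<close> the loss vanishes at \<open>m = 1\<close>, so the smallest scale works
      for every \<open>n\<close>.\<close>
    also have "\<dots> \<le> real (m - 1) * C"
      using l m by (intro mult_right_mono C of_nat_mono) (auto simp: min_def)
    finally show "?H l \<le> real (m - 1) * C" .
  qed
  also have "\<dots> \<le> 2 * real m * real (m - 1) * C"
  proof -
    have "card ?R \<le> 2 * m" using m by (subst card_Un_disjoint) auto
    hence "real (card ?R) \<le> 2 * real m" by linarith
    thus ?thesis using C by (simp add: mult_right_mono mult.assoc[symmetric])
  qed
  also have "sum ?H ?Z \<le> 0"
  proof (rule sum_nonpos)
    fix l assume l: "l \<in> ?Z"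
    have "?H l \<le> real (min n l - min n (l - m)) * C" by (rule G) auto
    moreover have "min n l = n" "min n (l - m) = n" using l by auto
    ultimately show "?H l \<le> 0" by simp
  qed
  finally show ?thesis by simp
qed

text \<open>Scale \<open>i\<close> looks at the \<open>512 ^ i\<close> most recent bits of a stream, without the
  \<open>cutoff i\<close> most recent ones, so that different scales use disjoint bits.\<close>

definition cutoff :: "nat \<Rightarrow> nat" where
  "cutoff i = (if i = 0 then 0 else 512 ^ (i - 1))"

lemma cutoff_le: "512 * cutoff i \<le> 512 ^ i"
  by (cases i) (auto simp: cutoff_def)

lemma cutoff_mono: "i < i' \<Longrightarrow> 512 ^ i \<le> cutoff i'"
  by (auto simp: cutoff_def intro!: power_increasing)

lemma sum_scales_le:
  fixes B :: "nat \<Rightarrow> real"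
  assumes "l \<le> n" "\<And>p. B p \<ge> 0"
  shows "(\<Sum>i | i < L \<and> 512 ^ i \<le> l. \<Sum>j<t. sum B (spos t j (l - 512 ^ i) (l - cutoff i)))
    \<le> (\<Sum>p<n * t. B p)"
proof -
  let ?I = "{i. i < L \<and> 512 ^ i \<le> l} \<times> {..<t}"
  let ?Q = "\<lambda>(i, j). spos t j (l - 512 ^ i) (l - cutoff i)"
  have fin: "finite {i. i < L \<and> 512 ^ i \<le> l}" by simp
  have "(\<Sum>i | i < L \<and> 512 ^ i \<le> l. \<Sum>j<t. sum B (spos t j (l - 512 ^ i) (l - cutoff i)))
      = (\<Sum>ij\<in>?I. sum B (?Q ij))"
    by (simp add: sum.cartesian_product case_prod_unfold)
  also have "\<dots> = sum B (\<Union>(?Q ` ?I))"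
  proof (rule sum.UNION_disjoint[symmetric])
    show "finite ?I" using fin by simp
    show "\<forall>ij\<in>?I. finite (?Q ij)" by (auto simp: spos_def)
    \<comment> \<open>A common bit would be among the last \<open>512 ^ i\<close> before
      \<open>l\<close>, all of which scale \<open>i'\<close> cuts off.\<close>
    have le: False
      if "i < i'" "512 ^ i \<le> l" "512 ^ i' \<le> l" "l - 512 ^ i \<le> q" "q < l - cutoff i'" for i i' q
      using that cutoff_mono[OF that(1)] by linarith
    show "\<forall>ij\<in>?I. \<forall>ij'\<in>?I. ij \<noteq> ij' \<longrightarrow> ?Q ij \<inter> ?Q ij' = {}"
    proof (intro ballI impI equals0I)
      fix ij ij' p assume a: "ij \<in> ?I" "ij' \<in> ?I" "ij \<noteq> ij'" "p \<in> ?Q ij \<inter> ?Q ij'"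
      obtain i j i' j' where [simp]: "ij = (i,j)" "ij' = (i',j')" by fastforce
      have p: "p mod t = j" "l - 512 ^ i \<le> p div t" "p div t < l - cutoff i"
          "p mod t = j'" "l - 512 ^ i' \<le> p div t" "p div t < l - cutoff i'"
        using a by (auto simp: mem_spos_iff)
      hence "i \<noteq> i'" using a(3) by auto
      thus False using le[of i i' "p div t"] le[of i' i "p div t"] p a(1,2)
        by (cases "i < i'") auto
    qed
  qed
  also have "\<dots> \<le> (\<Sum>p<n * t. B p)"
  proof (rule sum_mono2)
    show "\<Union>(?Q ` ?I) \<subseteq> {..<n * t}"
    proof
      fix p assume "p \<in> \<Union>(?Q ` ?I)"
      then obtain i j where "j < t" "p \<in> spos t j (l - 512 ^ i) (l - cutoff i)" by auto
      hence "p < (l - cutoff i) * t" using spos_subset by fastforce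
      also have "\<dots> \<le> n * t" using assms(1) by (intro mult_le_mono1) simp
      finally show "p \<in> {..<n * t}" by simp
    qed
  qed (use assms(2) in auto)
  finally show ?thesis .
qed

section \<open>Second moments explained by the memory\<close>

locale stream_alg = multipass f init k "n * t"
  for f :: "nat \<Rightarrow> nat \<Rightarrow> bool \<Rightarrow> nat \<Rightarrow> nat" and init k n t :: nat +
  assumes n_pos: "n \<ge> 1" and t_pos: "t \<ge> 1"
begin

abbreviation A where "A \<equiv> bits (n * t)"

definition explained :: "nat \<Rightarrow> nat \<Rightarrow> nat \<Rightarrow> nat \<Rightarrow> real" where
  "explained j a b l = (\<Sum>x\<in>A. (block_avg (spos t j a b) (a * t) (l * t) x)\<^sup>2)"

lemma spos_subset_all: "j < t \<Longrightarrow> b \<le> n \<Longrightarrow> spos t j a b \<subseteq> {..<n * t}"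
  by (rule order_trans[OF spos_subset]) (auto intro: order_less_le_trans mult_le_mono1)

lemma sum_coinsum_spos_power2:
  "j < t \<Longrightarrow> b \<le> n \<Longrightarrow> (\<Sum>x\<in>A. (coinsum (spos t j a b) x)\<^sup>2) = real (b - a) * real (card A)"
  using t_pos by (subst sum_coinsum_power2[OF spos_subset_all]) (auto simp: card_spos)

lemma explained_le:
  assumes "j < t" "b \<le> n"
  shows "explained j a b l \<le> real (b - a) * real (card A)"
  unfolding explained_def block_avg_def
  by (rule order_trans[OF sum_cavg_power2_le]) (use assms in \<open>simp_all add: sum_coinsum_spos_power2 del: card_bits\<close>)

text \<open>Split the window sum at \<open>l - w\<close>: the square of a sum is at most twice the
  sum of the squares, and conditioning does not increase the second moment \<open>w\<close> of the
  dropped part.\<close>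

lemma explained_cutoff:
  assumes "j < t" "w \<le> m" "m \<le> l" "l \<le> n"
  shows "explained j (l - m) l l \<le> 2 * explained j (l - m) (l - w) l + 2 * real w * real (card A)"
proof -
  let ?\<kappa> = "\<lambda>x. (mem ((l - m) * t) x, mem (l * t) x)"
  let ?u = "cavg A ?\<kappa> (coinsum (spos t j (l - m) (l - w)))"
  let ?v = "cavg A ?\<kappa> (coinsum (spos t j (l - w) l))"
  have "explained j (l - m) l l = (\<Sum>x\<in>A. (?u x + ?v x)\<^sup>2)"
  proof -
    have "coinsum (spos t j (l - m) l) =
        (\<lambda>x. coinsum (spos t j (l - m) (l - w)) x + coinsum (spos t j (l - w) l) x)"
      using assms t_pos by (intro ext coinsum_spos_split) auto
    thus ?thesis by (simp add: explained_def block_avg_def cavg_add)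
  qed
  also have "\<dots> \<le> (\<Sum>x\<in>A. 2 * (?u x)\<^sup>2 + 2 * (?v x)\<^sup>2)"
  proof (rule sum_mono)
    fix x
    have "0 \<le> (?u x - ?v x)\<^sup>2" by simp
    thus "(?u x + ?v x)\<^sup>2 \<le> 2 * (?u x)\<^sup>2 + 2 * (?v x)\<^sup>2"
      by (simp add: power2_eq_square algebra_simps)
  qed
  also have "\<dots> = 2 * explained j (l - m) (l - w) l + 2 * (\<Sum>x\<in>A. (?v x)\<^sup>2)"
    by (simp add: explained_def block_avg_def sum.distrib sum_distrib_left)
  also have "(\<Sum>x\<in>A. (?v x)\<^sup>2) \<le> (\<Sum>x\<in>A. (coinsum (spos t j (l - w) l) x)\<^sup>2)"
    by (rule sum_cavg_power2_le) simp
  also have "\<dots> = real w * real (card A)"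
    using assms by (simp add: sum_coinsum_spos_power2 del: card_bits)
  finally show ?thesis by simp
qed

lemma explained_le_bias:
  assumes "j < t" "w \<le> m" "m \<le> l" "l \<le> n"
  shows "explained j (l - m) (l - w) l \<le>
    real m * (\<Sum>p\<in>spos t j (l - m) (l - w). \<Sum>x\<in>A. (bias (l * t) p x)\<^sup>2)"
proof -
  have "explained j (l - m) (l - w) l \<le> real (card (spos t j (l - m) (l - w))) *
      (\<Sum>p\<in>spos t j (l - m) (l - w). \<Sum>x\<in>A. (bias (l * t) p x)\<^sup>2)"
    unfolding explained_def
  proof (rule sum_block_avg_power2_le_bias)
    show "spos t j (l - m) (l - w) \<subseteq> {(l - m) * t..<l * t}"
      by (rule order_trans[OF spos_subset[OF assms(1)]])
         (auto intro: order_less_le_trans mult_le_mono1)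
  qed (use assms in \<open>auto intro!: mult_le_mono1\<close>)
  also have "\<dots> \<le> real m * (\<Sum>p\<in>spos t j (l - m) (l - w). \<Sum>x\<in>A. (bias (l * t) p x)\<^sup>2)"
    using t_pos by (intro mult_right_mono) (auto simp: card_spos intro!: sum_nonneg)
  finally show ?thesis .
qed

text \<open>The mean of \<open>\<bar>S\<bar>\<close> is at least \<open>s / 4\<close>. A wrong
  answer costs at most \<open>2 * \<bar>S\<bar>\<close>, hence at most
  \<open>S\<^sup>2 / (16 * s) + 16 * s\<close>: the first term costs \<open>s / 16\<close> in the
  mean, the second \<open>s / 16\<close> at error rate \<open>1 / 256\<close>, which leaves
  \<open>s / 8\<close>.\<close>

lemma sum_output_ge:
  assumes g1: "\<And>j x. g j x = 1 \<or> g j x = (-1 :: real)"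
    and err: "(\<Sum>j<t. real (card {x \<in> A. g j x * coinsum (spos t j 0 n) x \<noteq> \<bar>coinsum (spos t j 0 n) x\<bar>}))
      \<le> real t * real (card A) / 256"
  shows "real t * sqrt (real n) * real (card A) / 8 \<le>
    (\<Sum>j<t. \<Sum>x\<in>A. coinsum (spos t j 0 n) x * g j x)"
proof -
  define s where "s = sqrt (real n)"
  have s: "s > 0" "s\<^sup>2 = real n" using n_pos by (auto simp: s_def)
  let ?S = "\<lambda>j. coinsum (spos t j 0 n)"
  let ?W = "\<lambda>j. {x \<in> A. g j x * ?S j x \<noteq> \<bar>?S j x\<bar>}"
  have one: "s * real (card A) * 3 / 16 - 16 * s * real (card (?W j)) \<le> (\<Sum>x\<in>A. ?S j x * g j x)"
    if j: "j < t" for j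
  proof -
    have pt: "\<bar>?S j x\<bar> - (?S j x)\<^sup>2 / (16 * s) - (if x \<in> ?W j then 16 * s else 0) \<le> ?S j x * g j x"
      if x: "x \<in> A" for x
    proof (cases "x \<in> ?W j")
      case True
      have "0 \<le> (\<bar>?S j x\<bar> - 16 * s)\<^sup>2 / (16 * s)" using s by simp
      also have "\<dots> = (?S j x)\<^sup>2 / (16 * s) - 2 * \<bar>?S j x\<bar> + 16 * s"
        using s by (simp add: power2_diff field_simps power2_eq_square)
      finally have "2 * \<bar>?S j x\<bar> \<le> (?S j x)\<^sup>2 / (16 * s) + 16 * s" by simp
      moreover have "- \<bar>?S j x\<bar> \<le> ?S j x * g j x"
        using g1[of j x] by (elim disjE) auto
      ultimately show ?thesis using True by simp
    next
      case False
      hence "?S j x * g j x = \<bar>?S j x\<bar>" using x by (simp add: mult.commute)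
      moreover have "(if x \<in> ?W j then 16 * s else 0) = 0" using False by (rule if_not_P)
      moreover have "0 \<le> (?S j x)\<^sup>2 / (16 * s)" using s by simp
      ultimately show ?thesis by linarith
    qed
    have cardW: "16 * s * real (card (?W j)) = (\<Sum>x\<in>A. if x \<in> ?W j then 16 * s else 0)"
    proof -
      have "(\<Sum>x\<in>A. if x \<in> ?W j then 16 * s else 0) = (\<Sum>x\<in>A \<inter> ?W j. 16 * s)"
        by (rule sum.inter_restrict[symmetric]) simp
      also have "A \<inter> ?W j = ?W j" by auto
      finally show ?thesis by simp
    qed
    have "s * real (card A) * 3 / 16 - 16 * s * real (card (?W j)) =
        s / 4 * real (card A) - s\<^sup>2 * real (card A) / (16 * s) - 16 * s * real (card (?W j))"
      using s(1) by (simp add: power2_eq_square del: card_bits)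
    also have "\<dots> \<le> (\<Sum>x\<in>A. \<bar>?S j x\<bar>) - (\<Sum>x\<in>A. (?S j x)\<^sup>2) / (16 * s) - 16 * s * real (card (?W j))"
    proof -
      have "spos t j 0 n \<noteq> {}" using n_pos by (simp add: spos_def)
      from sum_abs_coinsum_ge[OF spos_subset_all[OF j order.refl] this]
      have "s / 4 * real (card A) \<le> (\<Sum>x\<in>A. \<bar>?S j x\<bar>)"
        using t_pos by (simp add: card_spos s_def del: card_bits)
      thus ?thesis using j by (simp add: sum_coinsum_spos_power2 s del: card_bits)
    qed
    also have "(\<Sum>x\<in>A. \<bar>?S j x\<bar>) - (\<Sum>x\<in>A. (?S j x)\<^sup>2) / (16 * s) - 16 * s * real (card (?W j)) =
        (\<Sum>x\<in>A. \<bar>?S j x\<bar> - (?S j x)\<^sup>2 / (16 * s) - (if x \<in> ?W j then 16 * s else 0))"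
      by (simp only: sum_subtractf sum_divide_distrib cardW)
    also have "\<dots> \<le> (\<Sum>x\<in>A. ?S j x * g j x)" by (intro sum_mono pt)
    finally show ?thesis .
  qed
  have "16 * s * (\<Sum>j<t. real (card (?W j))) \<le> 16 * s * (real t * real (card A) / 256)"
    using s by (intro mult_left_mono err) simp
  hence "real t * s * real (card A) / 8 \<le>
      real t * (s * real (card A) * 3 / 16) - 16 * s * (\<Sum>j<t. real (card (?W j)))"
    by (simp add: field_simps del: card_bits)
  also have "\<dots> = (\<Sum>j<t. s * real (card A) * 3 / 16 - 16 * s * real (card (?W j)))"
    by (simp add: sum_subtractf sum_distrib_left del: card_bits)
  also have "\<dots> \<le> (\<Sum>j<t. \<Sum>x\<in>A. ?S j x * g j x)" by (intro sum_mono one) simp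
  finally show ?thesis by (simp add: s_def del: card_bits)
qed

text \<open>On average over the streams the correlation with the answer is at least
  \<open>s / 8\<close>, where \<open>s = sqrt n\<close>, and at most
  \<open>s / 16 + 4 / s * V\<close> for the explained second moment \<open>V\<close>; so
  \<open>V\<close> is at least \<open>s\<^sup>2 / 64\<close>.\<close>

lemma sum_partition_explained_ge:
  assumes g: "\<And>j x y. x \<in> A \<Longrightarrow> y \<in> A \<Longrightarrow> mem (n * t) x = mem (n * t) y \<Longrightarrow> g j x = g j y"
    and g1: "\<And>j x. g j x = 1 \<or> g j x = (-1 :: real)"
    and err: "(\<Sum>j<t. real (card {x \<in> A. g j x * coinsum (spos t j 0 n) x \<noteq> \<bar>coinsum (spos t j 0 n) x\<bar>}))
      \<le> real t * real (card A) / 256"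
    and \<beta>: "mono \<beta>" "\<beta> 0 = 0" "\<beta> B = n" "\<And>i. \<beta> i \<le> n"
  shows "real t * real n * real (card A) / 64 \<le>
    (\<Sum>i<B. \<Sum>j<t. explained j (\<beta> i) (\<beta> (Suc i)) (\<beta> (Suc i)))"
proof -
  define s where "s = sqrt (real n)"
  have s: "s > 0" "s * s = real n" using n_pos by (auto simp: s_def)
  let ?V = "\<Sum>i<B. \<Sum>j<t. explained j (\<beta> i) (\<beta> (Suc i)) (\<beta> (Suc i))"
  have one: "(\<Sum>x\<in>A. coinsum (spos t j 0 n) x * g j x) \<le> s / 16 * real (card A) +
      4 / s * (\<Sum>i<B. explained j (\<beta> i) (\<beta> (Suc i)) (\<beta> (Suc i)))" if j: "j < t" for j
  proof -
    have "(\<Sum>x\<in>A. (\<Sum>i<B. coinsum (spos t j (\<beta> i) (\<beta> (Suc i))) x) * g j x) \<le>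
        s / 16 * real (card A) + 4 / s * (\<Sum>i<B. \<Sum>x\<in>A.
        (block_avg (spos t j (\<beta> i) (\<beta> (Suc i))) (\<beta> i * t) (\<beta> (Suc i) * t) x)\<^sup>2)"
    proof (rule sum_coinsum_mult_output_le)
      show "mono (\<lambda>i. \<beta> i * t)" using \<beta>(1) by (auto simp: mono_def)
      show "\<bar>g j x\<bar> \<le> 1" for x using g1[of j x] by auto
      show "\<beta> i * t \<le> n * t" for i by (intro mult_le_mono1 \<beta>)
      show "g j x = g j y" if "x \<in> A" "y \<in> A" "mem (n * t) x = mem (n * t) y" for x y
        using that by (rule g)
    qed (use s j in \<open>simp_all add: spos_subset\<close>)
    moreover have "(\<Sum>i<B. coinsum (spos t j (\<beta> i) (\<beta> (Suc i))) x) = coinsum (spos t j 0 n) x" for x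
      using sum_coinsum_spos[where t = t and \<beta> = \<beta> and B = B and j = j and x = x] t_pos \<beta> by simp
    ultimately show ?thesis by (simp add: explained_def del: card_bits)
  qed
  have "real t * s * real (card A) / 8 \<le> (\<Sum>j<t. \<Sum>x\<in>A. coinsum (spos t j 0 n) x * g j x)"
    unfolding s_def by (rule sum_output_ge[OF g1 err])
  also have "\<dots> \<le> (\<Sum>j<t. s / 16 * real (card A) +
      4 / s * (\<Sum>i<B. explained j (\<beta> i) (\<beta> (Suc i)) (\<beta> (Suc i))))"
    by (intro sum_mono one) simp
  also have "\<dots> = real t * s * real (card A) / 16 + 4 / s * ?V"
    by (subst sum.swap) (simp add: sum.distrib sum_distrib_left del: card_bits)
  finally have "real t * s * real (card A) / 16 \<le> 4 / s * ?V" by linarith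
  hence "s / 4 * (real t * s * real (card A) / 16) \<le> s / 4 * (4 / s * ?V)"
    using s by (intro mult_left_mono) auto
  also have "s / 4 * (4 / s * ?V) = ?V" using s by simp
  also have "s / 4 * (real t * s * real (card A) / 16) = real t * (s * s) * real (card A) / 64"
    by simp
  finally show ?thesis using s by simp
qed

text \<open>Summing the partition bound over all \<open>m\<close> offsets gives
  \<open>m * n / 64\<close> per stream and input. Clipped windows cost at most
  \<open>m * n / 128\<close> and the cutoff at most \<open>m * n / 256\<close>; the remaining
  \<open>m * n / 256\<close> is halved by the factor 2 in \<open>explained_cutoff\<close>.\<close>

lemma scale_ge:
  assumes g: "\<And>j x y. x \<in> A \<Longrightarrow> y \<in> A \<Longrightarrow> mem (n * t) x = mem (n * t) y \<Longrightarrow> g j x = g j y"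
    and g1: "\<And>j x. g j x = 1 \<or> g j x = (-1 :: real)"
    and err: "(\<Sum>j<t. real (card {x \<in> A. g j x * coinsum (spos t j 0 n) x \<noteq> \<bar>coinsum (spos t j 0 n) x\<bar>}))
      \<le> real t * real (card A) / 256"
    and m: "1 \<le> m" "m \<le> n" "256 * (m - 1) \<le> n" and w: "512 * w \<le> m"
  shows "real m * (real t * real n * real (card A) / 512) \<le>
    (\<Sum>l=m..n. \<Sum>j<t. explained j (l - m) (l - w) l)"
proof -
  let ?c = "real (card A)"
  let ?D = "real t * real n * ?c / 64"
  have "real m * ?D - 2 * real m * real (m - 1) * (real t * ?c) \<le>
      (\<Sum>l=m..n. \<Sum>j<t. explained j (l - m) l l)"
  proof (rule sliding_window_ge[OF m(1,2)])
    show "(\<Sum>j<t. explained j a b b) \<le> real (b - a) * (real t * ?c)" if "a \<le> b" "b \<le> n" for a b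
    proof -
      have "(\<Sum>j<t. explained j a b b) \<le> (\<Sum>j<t. real (b - a) * ?c)"
        using that by (intro sum_mono explained_le) auto
      thus ?thesis by (simp add: algebra_simps del: card_bits)
    qed
    fix r assume r: "r < m"
    \<comment> \<open>Truncated subtraction puts \<open>\<beta> 0\<close> at 0 because
      \<open>r < m\<close>, so the first block has length \<open>r\<close>;
      \<open>n * m \<ge> n\<close> makes the last boundary \<open>n\<close>.\<close>
    define \<beta> where "\<beta> i = min n (r + i * m - m)" for i
    have "n \<le> n * m" using m by simp
    hence "n \<le> r + n * m" by (rule trans_le_add2)
    moreover have "r + Suc n * m - m = r + n * m" by simp
    ultimately have end_n: "\<beta> (Suc n) = n" unfolding \<beta>_def by (simp only: min_absorb1)
    have mono: "mono \<beta>"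
    proof
      fix i i' :: nat assume "i \<le> i'"
      hence "i * m \<le> i' * m" by (rule mult_le_mono1)
      hence "r + i * m - m \<le> r + i' * m - m" by linarith
      thus "\<beta> i \<le> \<beta> i'" unfolding \<beta>_def by (rule min.mono[OF order.refl])
    qed
    have start_0: "\<beta> 0 = 0" and le_n: "\<beta> i \<le> n" for i using r by (simp_all add: \<beta>_def)
    have "?D \<le> (\<Sum>i<Suc n. \<Sum>j<t. explained j (\<beta> i) (\<beta> (Suc i)) (\<beta> (Suc i)))"
      by (rule sum_partition_explained_ge[OF g g1 err mono start_0 end_n le_n])
    moreover have "\<beta> (Suc i) = min n (r + i * m)" for i by (simp add: \<beta>_def)
    ultimately show "?D \<le> (\<Sum>i<Suc n. \<Sum>j<t. explained j (min n (r + i * m - m)) (min n (r + i * m))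
        (min n (r + i * m)))"
      by (simp only: \<beta>_def)
  qed simp
  also have "(\<Sum>l=m..n. \<Sum>j<t. explained j (l - m) l l) \<le>
      (\<Sum>l=m..n. \<Sum>j<t. 2 * explained j (l - m) (l - w) l + 2 * real w * ?c)"
    using w by (intro sum_mono explained_cutoff) auto
  also have "\<dots> = 2 * (\<Sum>l=m..n. \<Sum>j<t. explained j (l - m) (l - w) l) +
      real (Suc n - m) * (real t * (2 * real w * ?c))"
    by (simp add: sum.distrib sum_distrib_left del: card_bits)
  also have "real (Suc n - m) * (real t * (2 * real w * ?c)) \<le>
      real n * (real t * (2 * (real m / 512) * ?c))"
    using m w by (intro mult_mono) auto
  finally have "real m * ?D - 2 * real m * real (m - 1) * (real t * ?c) -
      real n * (real t * (2 * (real m / 512) * ?c)) \<le>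
      2 * (\<Sum>l=m..n. \<Sum>j<t. explained j (l - m) (l - w) l)" by linarith
  moreover have "real m * real t * ?c * (256 * real (m - 1)) \<le> real m * real t * ?c * real n"
  proof (rule mult_left_mono)
    show "256 * real (m - 1) \<le> real n" using m(3) by linarith
  qed simp
  ultimately show ?thesis by (simp add: algebra_simps del: card_bits)
qed

text \<open>Double counting over scales \<open>i\<close> and end positions \<open>l\<close>, per
  input: a scale yields at least \<open>t * n / 512\<close> over all \<open>l\<close>, while a
  position yields at most \<open>16 * k * s\<close> over all scales and streams, as its windows are
  disjoint. Scale 0 needs no size condition because windows of length 1 have no clipping
  loss.\<close>

lemma memory_lower_bound:
  assumes init: "init < 2 ^ s"
    and step: "\<And>p l b \<sigma>. p < k \<Longrightarrow> l < n * t \<Longrightarrow> \<sigma> < 2 ^ s \<Longrightarrow> f p l b \<sigma> < 2 ^ s"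
    and g: "\<And>j x y. x \<in> A \<Longrightarrow> y \<in> A \<Longrightarrow> mem (n * t) x = mem (n * t) y \<Longrightarrow> g j x = g j y"
    and g1: "\<And>j x. g j x = 1 \<or> g j x = (-1 :: real)"
    and err: "(\<Sum>j<t. real (card {x \<in> A. g j x * coinsum (spos t j 0 n) x \<noteq> \<bar>coinsum (spos t j 0 n) x\<bar>}))
      \<le> real t * real (card A) / 256"
    and L: "\<And>i. 0 < i \<Longrightarrow> i < L \<Longrightarrow> 256 * 512 ^ i \<le> n"
  shows "real L * real t \<le> 8192 * real k * real s"
proof -
  let ?c = "real (card A)"
  let ?E = "\<lambda>i l. \<Sum>j<t. explained j (l - 512 ^ i) (l - cutoff i) l / 512 ^ i"
  have scale: "real t * real n * ?c / 512 \<le> (\<Sum>l=512 ^ i..n. ?E i l)" if i: "i < L" for i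
  proof -
    have m: "(512 :: nat) ^ i \<le> n" "256 * (512 ^ i - 1) \<le> n"
      using L[of i] i n_pos by (cases "i = 0"; simp)+
    have "real (512 ^ i) * (real t * real n * ?c / 512) \<le>
        (\<Sum>l=512 ^ i..n. \<Sum>j<t. explained j (l - 512 ^ i) (l - cutoff i) l)"
      by (rule scale_ge[OF g g1 err _ m cutoff_le]) auto
    thus ?thesis
      by (simp add: sum_divide_distrib[symmetric] pos_le_divide_eq mult.commute del: card_bits)
  qed
  have time: "(\<Sum>i | i < L \<and> 512 ^ i \<le> l. ?E i l) \<le> 16 * real k * real s * ?c" if l: "l \<le> n" for l
  proof -
    let ?B = "\<lambda>p. \<Sum>x\<in>A. (bias (l * t) p x)\<^sup>2"
    have "(\<Sum>i | i < L \<and> 512 ^ i \<le> l. ?E i l) \<le>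
        (\<Sum>i | i < L \<and> 512 ^ i \<le> l. \<Sum>j<t. sum ?B (spos t j (l - 512 ^ i) (l - cutoff i)))"
    proof (intro sum_mono)
      fix i j assume i: "i \<in> {i. i < L \<and> 512 ^ i \<le> l}" and j: "j \<in> {..<t}"
      have "cutoff i \<le> 512 ^ i" using cutoff_le[of i] by linarith
      hence "explained j (l - 512 ^ i) (l - cutoff i) l \<le>
          real (512 ^ i) * sum ?B (spos t j (l - 512 ^ i) (l - cutoff i))"
        using i j l by (intro explained_le_bias) auto
      thus "explained j (l - 512 ^ i) (l - cutoff i) l / 512 ^ i \<le>
          sum ?B (spos t j (l - 512 ^ i) (l - cutoff i))"
        by (simp add: pos_divide_le_eq mult.commute)
    qed
    also have "\<dots> \<le> (\<Sum>p<n * t. ?B p)"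
      using l by (intro sum_scales_le) (auto intro: sum_nonneg)
    also have "\<dots> \<le> 16 * real k * real s * ?c"
      using l by (intro sum_bias_le_memory init step mult_le_mono1) auto
    finally show ?thesis .
  qed
  have "real L * (real t * real n * ?c / 512) = (\<Sum>i<L. real t * real n * ?c / 512)" by simp
  also have "\<dots> \<le> (\<Sum>i<L. \<Sum>l=512 ^ i..n. ?E i l)" by (intro sum_mono scale) simp
  also have "\<dots> = (\<Sum>i<L. \<Sum>l | l \<in> {1..n} \<and> 512 ^ i \<le> l. ?E i l)"
  proof (intro sum.cong refl)
    fix i
    have "1 \<le> l" if "512 ^ i \<le> l" for l :: nat by (rule order_trans[OF _ that]) simp
    thus "{512 ^ i..n} = {l. l \<in> {1..n} \<and> 512 ^ i \<le> l}" by auto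
  qed
  also have "\<dots> = (\<Sum>l=1..n. \<Sum>i | i \<in> {..<L} \<and> 512 ^ i \<le> l. ?E i l)"
    by (rule sum.swap_restrict) auto
  also have "\<dots> \<le> (\<Sum>l=1..n. 16 * real k * real s * ?c)"
    using time by (intro sum_mono) simp
  also have "\<dots> = (real n * ?c / 512) * (8192 * real k * real s)" by simp
  finally have "(real n * ?c / 512) * (real L * real t) \<le> (real n * ?c / 512) * (8192 * real k * real s)"
    by (simp add: mult_ac del: card_bits)
  moreover have "real n * ?c / 512 > 0" using n_pos by simp
  ultimately show ?thesis by (rule mult_left_le_imp_le)
qed

end

section \<open>Fixing the seed\<close>

lemma prob_bind_pmf_le:
  assumes "\<And>r. measure_pmf.prob (N r) X \<le> q"
  shows "measure_pmf.prob (bind_pmf M N) X \<le> q"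
proof -
  have "q \<ge> 0" using assms[of undefined] measure_nonneg order_trans by blast
  have "ennreal (measure_pmf.prob (bind_pmf M N) X) = (\<integral>\<^sup>+ r. emeasure (N r) X \<partial>M)"
    by (simp add: measure_pmf.emeasure_eq_measure[symmetric])
  also have "\<dots> \<le> (\<integral>\<^sup>+ r. ennreal q \<partial>M)"
    using assms by (intro nn_integral_mono) (simp add: measure_pmf.emeasure_eq_measure ennreal_leI)
  also have "\<dots> = ennreal q" by (simp add: measure_pmf.emeasure_space_1)
  finally show ?thesis using \<open>q \<ge> 0\<close> by simp
qed

lemma pair_pmf_of_set:
  assumes "finite A" "A \<noteq> {}" "finite B" "B \<noteq> {}"
  shows "pair_pmf (pmf_of_set A) (pmf_of_set B) = pmf_of_set (A \<times> B)"
proof (rule pmf_eqI)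
  fix z
  show "pmf (pair_pmf (pmf_of_set A) (pmf_of_set B)) z = pmf (pmf_of_set (A \<times> B)) z"
    using assms by (cases z) (simp add: pmf_pair indicator_def card_cartesian_product)
qed

lemma inputs_eq_bits: "inputs n t = bits (n * t)"
  by (simp add: inputs_def bits_def)

text \<open>If every seed succeeded with probability at most \<open>1 - 1 / 256\<close>, so would
  the mixture, against \<open>1 - 1 / 512\<close>. A better seed errs on at most a
  \<open>1 / 256\<close> fraction of the pairs of input and query.\<close>

lemma obtain_good_seed:
  assumes t: "t \<ge> 1" and succ: "success_prob n t k R init step out \<ge> 1 - 1 / 512"
  obtains r where "(\<Sum>j<t. real (card {x \<in> bits (n * t).
      out r j (run_all init step k r t x) \<noteq> majority n t x j}))
      \<le> real t * real (card (bits (n * t))) / 256"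
proof -
  let ?A = "bits (n * t)"
  let ?ok = "\<lambda>r. {(x, j). out r j (run_all init step k r t x) = majority n t x j}"
  let ?X = "{(x, r, j). out r j (run_all init step k r t x) = majority n t x j}"
  let ?N = "\<lambda>r. pmf_of_set (inputs n t) \<bind> (\<lambda>x. pmf_of_set {..<t} \<bind> (\<lambda>j. return_pmf (x, r, j)))"
  have ne: "?A \<noteq> {}" using card_bits[of "n * t"] by (metis card.empty power_not_zero zero_neq_numeral)
  have tne: "{..<t} \<noteq> {}" using t by (metis One_nat_def empty_iff lessThan_iff less_eq_Suc_le)
  have prob: "measure_pmf.prob (?N r) ?X = card ((?A \<times> {..<t}) \<inter> ?ok r) / card (?A \<times> {..<t})" for r
  proof -
    have "?N r = map_pmf (\<lambda>(x, j). (x, r, j)) (pair_pmf (pmf_of_set ?A) (pmf_of_set {..<t}))"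
      by (simp add: pair_pmf_def map_pmf_def bind_assoc_pmf bind_return_pmf inputs_eq_bits)
    also have "pair_pmf (pmf_of_set ?A) (pmf_of_set {..<t}) = pmf_of_set (?A \<times> {..<t})"
      using ne tne by (intro pair_pmf_of_set) auto
    finally have "measure_pmf.prob (?N r) ?X =
        measure_pmf.prob (pmf_of_set (?A \<times> {..<t})) ((\<lambda>(x, j). (x, r, j)) -` ?X)" by simp
    also have "(\<lambda>(x, j). (x, r, j)) -` ?X = ?ok r" by auto
    also have "measure_pmf.prob (pmf_of_set (?A \<times> {..<t})) (?ok r) =
        card ((?A \<times> {..<t}) \<inter> ?ok r) / card (?A \<times> {..<t})"
      using ne tne by (intro measure_pmf_of_set) auto
    finally show ?thesis .
  qed
  \<comment> \<open>The seed is independent of the input and may be drawn first.\<close>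
  have "success_prob n t k R init step out = measure_pmf.prob (bind_pmf R ?N) ?X"
    unfolding success_prob_def by (subst bind_commute_pmf) (rule refl)
  hence ge: "1 - 1 / 512 \<le> measure_pmf.prob (bind_pmf R ?N) ?X" using succ by simp
  have "\<not> (\<forall>r. measure_pmf.prob (?N r) ?X \<le> 1 - 1 / 256)"
  proof
    assume all: "\<forall>r. measure_pmf.prob (?N r) ?X \<le> 1 - 1 / 256"
    have "measure_pmf.prob (bind_pmf R ?N) ?X \<le> 1 - 1 / 256"
      by (rule prob_bind_pmf_le) (rule all[rule_format])
    thus False using ge by linarith
  qed
  then obtain r where r: "1 - 1 / 256 < measure_pmf.prob (?N r) ?X" by (auto simp: not_le)
  have S: "finite (?A \<times> {..<t})" "real (card (?A \<times> {..<t})) = real t * real (card ?A)"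
    by (simp_all add: card_cartesian_product)
  have pos: "real t * real (card ?A) > 0" using t by simp
  have "(\<Sum>j<t. card {x \<in> ?A. out r j (run_all init step k r t x) \<noteq> majority n t x j}) =
      card (SIGMA j:{..<t}. {x \<in> ?A. out r j (run_all init step k r t x) \<noteq> majority n t x j})"
    by (subst card_SigmaI) auto
  also have "\<dots> = card ((?A \<times> {..<t}) - ?ok r)"
    by (rule bij_betw_same_card[of prod.swap]) (auto simp: bij_betw_def inj_on_def image_iff)
  also have "\<dots> = card (?A \<times> {..<t}) - card ((?A \<times> {..<t}) \<inter> ?ok r)"
    by (rule card_Diff_subset_Int) (rule finite_subset[OF _ S(1)], auto)
  finally have "(\<Sum>j<t. real (card {x \<in> ?A. out r j (run_all init step k r t x) \<noteq> majority n t x j})) =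
      real (card (?A \<times> {..<t})) - real (card ((?A \<times> {..<t}) \<inter> ?ok r))"
    using card_mono[OF S(1), of "(?A \<times> {..<t}) \<inter> ?ok r"]
    by (simp only: of_nat_sum[symmetric]) (simp add: of_nat_diff)
  also have "\<dots> \<le> real t * real (card ?A) / 256"
    using r pos unfolding prob S(2) by (simp add: less_divide_eq del: card_bits)
  finally show ?thesis by (rule that)
qed

lemma coinsum_stream:
  assumes "t \<ge> 1"
  shows "coinsum (spos t j 0 n) x = real_of_int (\<Sum>i<n. bitval (x ! (i * t + j)))"
proof -
  have "inj_on (\<lambda>i. i * t + j) {0..<n}" using assms by (auto simp: inj_on_def)
  thus ?thesis by (simp add: coinsum_def spos_def sum.reindex coin_def lessThan_atLeast0)
qed

theorem theorem1p4:
  shows "\<exists>c \<gamma> c'. c > 0 \<and> \<gamma> > 0 \<and> c' > (0::real) \<and>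
    (\<forall>n t k s (R :: nat pmf) init step out.
       k \<ge> 1 \<longrightarrow> t \<ge> 1 \<longrightarrow>
       real k < log 2 (real n) \<longrightarrow> real t < real n powr c \<longrightarrow>
       memory_bounded s n t k init step \<longrightarrow>
       success_prob n t k R init step out \<ge> 1 - \<gamma> \<longrightarrow>
       real s \<ge> c' * real t * log 2 (real n) / real k)"
\<comment> \<open>\<open>147456 = 18 * 8192\<close>: about \<open>log 2 n / 18\<close> scales are
  available, and 8192 comes from \<open>memory_lower_bound\<close>. The error \<open>1 / 512\<close>
  is doubled by fixing the seed.\<close>
proof (rule exI[of _ 1], rule exI[of _ "1 / 512"], rule exI[of _ "1 / 147456"],
    intro conjI allI impI)
  fix n t k s :: nat and R :: "nat pmf" and init step out
  assume k: "k \<ge> 1" and t: "t \<ge> 1" and kn: "real k < log 2 (real n)"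
    and mem: "memory_bounded s n t k init step"
    and succ: "success_prob n t k R init step out \<ge> 1 - 1 / 512"
  \<comment> \<open>At \<open>n = 0\<close> the default \<open>ln 0 = 0\<close> would force
    \<open>real k < 0\<close>.\<close>
  have n: "n \<ge> 1" using k kn by (cases n) (auto simp: log_def)
  obtain r where r: "(\<Sum>j<t. real (card {x \<in> bits (n * t).
      out r j (run_all init step k r t x) \<noteq> majority n t x j}))
      \<le> real t * real (card (bits (n * t))) / 256"
    by (rule obtain_good_seed[OF t succ])
  define f where "f p l b = step r p l (bitval b, l mod t + 1)" for p l b
  interpret stream_alg f "init r" k n t by unfold_locales (fact n, fact t)
  \<comment> \<open>Every answer other than 1 is read as -1, so that \<open>g\<close> is always a
    sign.\<close>
  define g where "g j x = (if out r j (start x k) = 1 then 1 else -1 :: real)" for j x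
  have run: "run_all init step k r t x = start x k" if "x \<in> A" for x
  proof -
    have "run_pass step r t x = (\<lambda>p \<sigma>. seg p x \<sigma> (n * t))"
      using that by (intro ext) (simp add: run_pass_def seg_def f_def bits_def)
    moreover have "fold (\<lambda>p \<sigma>. seg p x \<sigma> (n * t)) [0..<p] (init r) = start x p" for p
      by (induction p) auto
    ultimately show ?thesis by (simp add: run_all_def)
  qed
  have err: "(\<Sum>j<t. real (card {x \<in> A. g j x * coinsum (spos t j 0 n) x \<noteq> \<bar>coinsum (spos t j 0 n) x\<bar>}))
      \<le> real t * real (card A) / 256"
  proof (rule order_trans[OF sum_mono r])
    fix j
    have "out r j (run_all init step k r t x) \<noteq> majority n t x j"
      if "x \<in> A" "g j x * coinsum (spos t j 0 n) x \<noteq> \<bar>coinsum (spos t j 0 n) x\<bar>" for x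
    proof
      let ?S = "\<Sum>i<n. bitval (x ! (i * t + j))"
      assume "out r j (run_all init step k r t x) = majority n t x j"
      hence "g j x = (if 0 \<le> ?S then 1 else -1)"
        unfolding g_def run[OF that(1)] majority_def by simp
      hence "g j x * coinsum (spos t j 0 n) x = \<bar>coinsum (spos t j 0 n) x\<bar>"
        unfolding coinsum_stream[OF t] by (simp del: of_int_sum)
      thus False using that(2) by simp
    qed
    thus "real (card {x \<in> A. g j x * coinsum (spos t j 0 n) x \<noteq> \<bar>coinsum (spos t j 0 n) x\<bar>})
        \<le> real (card {x \<in> A. out r j (run_all init step k r t x) \<noteq> majority n t x j})"
      by (intro of_nat_mono card_mono) auto
  qed
  \<comment> \<open>As \<open>k \<ge> 1\<close>, the final state is the last entry of
    \<open>mem (n * t)\<close>.\<close>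
  have answer: "g j x = g j y" if "mem (n * t) x = mem (n * t) y" for j x y
  proof -
    obtain p where p: "k = Suc p" using k by (cases k) auto
    have "start x k = start y k"
      using that[unfolded mem_eq_iff, rule_format, of p] p by simp
    thus ?thesis by (simp add: g_def)
  qed
  \<comment> \<open>\<open>256 * 512 ^ i = 2 ^ (8 + 9 * i)\<close> is at most
    \<open>2 ^ (18 * i)\<close> for \<open>i \<ge> 1\<close>; \<open>Suc\<close> counts scale 0 and
    compensates for the floor.\<close>
  define L where "L = Suc (nat \<lfloor>log 2 (real n) / 18\<rfloor>)"
  have scales: "256 * 512 ^ i \<le> n" if "0 < i" "i < L" for i
  proof -
    have "int i \<le> \<lfloor>log 2 (real n) / 18\<rfloor>" using that unfolding L_def by linarith
    hence "real i \<le> log 2 (real n) / 18" by (simp add: le_floor_iff)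
    hence "real (18 * i) \<le> log 2 (real n)" by simp
    hence "(2 :: real) ^ (18 * i) \<le> real n"
      using n by (subst (asm) le_log_iff) (simp_all add: powr_realpow del: of_nat_mult)
    hence "(2 :: nat) ^ (18 * i) \<le> n" by (metis of_nat_le_iff of_nat_numeral of_nat_power)
    moreover have "256 * 512 ^ i = (2 :: nat) ^ (8 + 9 * i)" by (simp add: power_add power_mult)
    moreover have "(2 :: nat) ^ (8 + 9 * i) \<le> 2 ^ (18 * i)"
      using that(1) by (intro power_increasing) auto
    ultimately show ?thesis by linarith
  qed
  have "real L * real t \<le> 8192 * real k * real s"
  proof (rule memory_lower_bound[OF _ _ _ _ err scales])
    show "init r < 2 ^ s" using mem by (simp add: memory_bounded_def)
    show "f p l b \<sigma> < 2 ^ s" if "p < k" "l < n * t" "\<sigma> < 2 ^ s" for p l b \<sigma>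
      using mem that by (simp add: memory_bounded_def f_def)
    show "g j x = g j y" if "mem (n * t) x = mem (n * t) y" for j x y
      using that by (rule answer)
    show "g j x = 1 \<or> g j x = -1" for j x by (simp add: g_def)
  qed
  moreover have "log 2 (real n) / 18 * real t \<le> real L * real t"
    unfolding L_def by (intro mult_right_mono) linarith+
  ultimately have "log 2 (real n) / 18 * real t \<le> 8192 * real k * real s" by linarith
  thus "real s \<ge> 1 / 147456 * real t * log 2 (real n) / real k"
    using k by (simp add: field_simps)
qed simp_all

end
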